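(* Let $n,d\in\mathbb N=\{1,2,\dots\}$. In the non-Hilbert cases $(n,2d)$, the following strict inclusions hold: $$\big(\Sigma_{n,2d}\cup C_{n,2d}\big)\subsetneq(\Sigma+C)_{n,2d}\subsetneq P_{n,2d}.$$
   Context: The Hilbert cases are the pairs $(n,2d)\in\{(2,2d),(n,2),(3,4)\}$, i.e. those with $n=2$, or $2d=2$, or $(n,2d)=(3,4)$; all other pairs $(n,2d)$ are the non-Hilbert cases. $H_{n,k}$ is the real vector space of forms of degree $k$ in $n$ variables. $P_{n,2d}=\{f\in H_{n,2d}: f(v)\ge0\ \forall v\in\mathbb R^n\}$. $\Sigma_{n,2d}\subseteq H_{n,2d}$ is the set of finite sums of squares of forms in $H_{n,d}$. For $f=\sum_\alpha f_\alpha x^\alpha\in H_{n,2d}$: $\operatorname{supp}(f)=\{\alpha\in\mathbb N_0^n:f_\alpha\neq0\}$, $\operatorname{New}(f)=\operatorname{conv}(\operatorname{supp}(f))$, $V(f)$ is the vertex set of $\operatorname{New}(f)$, $\mathcal S(f)=\{\alpha\in\operatorname{supp}(f):\alpha\in(2\mathbb N_0)^n,\ f_\alpha>0\}$, $\mathcal I(f)=\operatorname{supp}(f)\setminus\mathcal S(f)$. A form $f\in H_{n,2d}$ is a circuit if $\mathcal S(f)=V(f)$, $V(f)$ is affinely independent (single points and the empty set count as affinely independent), and either $\mathcal I(f)=\emptyset$ or $\mathcal I(f)=\{\beta\}$ with $\beta$ in the relative interior of $\operatorname{New}(f)$. It is a nonnegative circuit if moreover $f\in P_{n,2d}$. $C_{n,2d}$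 is the set of all finite sums of nonnegative circuits in $H_{n,2d}$. $(\Sigma+C)_{n,2d}=\{g+h: g\in\Sigma_{n,2d},\ h\in C_{n,2d}\}$.
   Formalization: The formal statement assumes n ≥ 2: for n = 1 and d ≥ 2 the pair would count as non-Hilbert, but every nonnegative form is c x^{2d} with c ≥ 0, so all the sets coincide and the strict inclusions fail. *)

theory Defs
  imports "HOL-Analysis.Analysis" "HOL-Library.Poly_Mapping"
begin

text \<open>Real polynomials in the variables \<open>x\<^sub>i\<close>, \<open>i :: 'n\<close>, so that the number of variables is
  \<open>n = CARD('n)\<close>. Such a polynomial is its finitely supported family of coefficients, indexed by the
  exponents in \<open>nat ^ 'n\<close>; the product of \<open>Poly_Mapping\<close> is the polynomial product, and
  \<open>supp(f)\<close> is \<open>Poly_Mapping.keys f\<close>.\<close>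

type_synonym 'n rpoly = "(nat ^ 'n) \<Rightarrow>\<^sub>0 real"

definition poly_eval :: "'n::finite rpoly \<Rightarrow> real ^ 'n \<Rightarrow> real" where
  "poly_eval f v =
     (\<Sum>\<alpha>\<in>Poly_Mapping.keys f. Poly_Mapping.lookup f \<alpha> * (\<Prod>i\<in>UNIV. (v $ i) ^ (\<alpha> $ i)))"

definition forms :: "nat \<Rightarrow> ('n::finite) rpoly set" where
  "forms k = {f. \<forall>\<alpha>\<in>Poly_Mapping.keys f. (\<Sum>i\<in>UNIV. \<alpha> $ i) = k}"

text \<open>The sets below are parametrised by \<open>d\<close>, half of the degree: \<open>psd_forms d\<close> is
  \<open>P\<^sub>n\<^sub>,\<^sub>2\<^sub>d\<close>, and likewise for the other cones.\<close>

definition psd_forms :: "nat \<Rightarrow> ('n::finite) rpoly set" where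
  "psd_forms d = {f \<in> forms (2 * d). \<forall>v. poly_eval f v \<ge> 0}"

definition sos_forms :: "nat \<Rightarrow> ('n::finite) rpoly set" where
  "sos_forms d = {f. \<exists>gs. set gs \<subseteq> forms d \<and> f = (\<Sum>g\<leftarrow>gs. g * g)}"

definition real_exponent :: "nat ^ 'n \<Rightarrow> real ^ 'n::finite" where
  "real_exponent \<alpha> = (\<chi> i. real (\<alpha> $ i))"

definition newton_polytope :: "'n::finite rpoly \<Rightarrow> (real ^ 'n) set" where
  "newton_polytope f = convex hull (real_exponent ` Poly_Mapping.keys f)"

definition newton_vertices :: "'n::finite rpoly \<Rightarrow> (real ^ 'n) set" where
  "newton_vertices f = {v. v extreme_point_of newton_polytope f}"

text \<open>\<open>\<S>(f)\<close> and \<open>\<I>(f)\<close>\<close>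

definition square_supp :: "'n::finite rpoly \<Rightarrow> (nat ^ 'n) set" where
  "square_supp f =
     {\<alpha> \<in> Poly_Mapping.keys f. (\<forall>i. even (\<alpha> $ i)) \<and> Poly_Mapping.lookup f \<alpha> > 0}"

definition inner_supp :: "'n::finite rpoly \<Rightarrow> (nat ^ 'n) set" where
  "inner_supp f = Poly_Mapping.keys f - square_supp f"

definition is_circuit :: "'n::finite rpoly \<Rightarrow> bool" where
  "is_circuit f \<longleftrightarrow>
     real_exponent ` square_supp f = newton_vertices f \<and>
     \<not> affine_dependent (newton_vertices f) \<and>
     (inner_supp f = {} \<or>
      (\<exists>\<beta>. inner_supp f = {\<beta>} \<and> real_exponent \<beta> \<in> rel_interior (newton_polytope f)))"

definition nonneg_circuits :: "nat \<Rightarrow> ('n::finite) rpoly set" where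
  "nonneg_circuits d = {f \<in> psd_forms d. is_circuit f}"

definition sonc_forms :: "nat \<Rightarrow> ('n::finite) rpoly set" where
  "sonc_forms d = {f. \<exists>cs. set cs \<subseteq> nonneg_circuits d \<and> f = sum_list cs}"

definition sos_plus_sonc_forms :: "nat \<Rightarrow> ('n::finite) rpoly set" where
  "sos_plus_sonc_forms d = {g + h | g h. g \<in> sos_forms d \<and> h \<in> sonc_forms d}"

text \<open>The Hilbert cases \<open>(n, k)\<close>, \<open>k\<close> being the (even) degree. As usual they are considered for
  \<open>n \<ge> 2\<close> only: for \<open>n = 1\<close> every nonnegative form is \<open>c x\<^sup>k\<close> with \<open>c \<ge> 0\<close>, hence a square and a
  circuit, although no clause below covers \<open>(1, k)\<close> with \<open>k \<ge> 4\<close>.\<close>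

definition hilbert_case :: "nat \<Rightarrow> nat \<Rightarrow> bool" where
  "hilbert_case n k \<longleftrightarrow> n = 2 \<or> k = 2 \<or> (n, k) = (3, 4)"

end

theory Submission
  imports Defs
begin

text \<open>
  If a form \<open>f\<close> is a sum of squares \<open>g\<^sup>2\<close> and of nonnegative circuits \<open>c\<close>, then \<open>g\<^sup>2 \<le> f\<close> and
  \<open>c \<le> f\<close> pointwise. Hence every \<open>g\<close> and \<open>c\<close> vanishes at the zeros of \<open>f\<close>, and half of the Newton
  polytope of \<open>f\<close> contains that of \<open>g\<close>.

  A nonnegative form outside \<open>(\<Sigma> + C)\<close> is Robinson's sextic times \<open>z\<^sup>2\<^sup>k\<close>, which vanishes at all points of
  \<open>{-1, 0, 1}\<^sup>2 \<times> {1}\<close> except \<open>(0, 0, 1)\<close>: a Cayley--Bacharach relation forces every \<open>g\<close> to vanish at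
  \<open>(0, 0, 1)\<close> too, and a circuit that vanishes at \<open>(1, 0, 1)\<close> and \<open>(0, 1, 1)\<close> must also vanish at
  \<open>(0, 0, 1)\<close>, because it has only one exponent that can contribute a negative term. For quartics the
  same works with Robinson's quartic on \<open>{0, 1}\<^sup>3 \<times> {1}\<close>.

  A form in \<open>(\<Sigma> + C)\<close> outside \<open>\<Sigma> \<union> C\<close> is \<open>q\<^sup>2 + h\<close>, where \<open>h\<close> is the Motzkin form times \<open>z\<^sup>2\<^sup>k\<close> (the
  Choi--Lam form for quartics) and \<open>q\<^sup>2\<close> is chosen with its Newton polytope inside that of \<open>h\<close>, so that the
  inner coefficient still obstructs sums of squares. Choosing the sign of one variable shows that the
  non-even coefficients of a sum of nonnegative circuits are dominated in absolute value by the even ones,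
  and the cross terms of \<open>q\<^sup>2\<close> violate this.
\<close>

section \<open>Coefficients, evaluation and the cones\<close>

text \<open>The linear functional sending the monomial with exponent \<alpha> to
  \<open>\<phi> \<alpha>\<close>. Evaluation, extraction of one coefficient and signed coefficient
  sums are all of this kind, so linearity and the product rule are proved only once.\<close>

definition coeff_sum :: "(nat ^ 'n \<Rightarrow> real) \<Rightarrow> 'n::finite rpoly \<Rightarrow> real" where
  "coeff_sum \<phi> f = (\<Sum>\<alpha>\<in>Poly_Mapping.keys f. Poly_Mapping.lookup f \<alpha> * \<phi> \<alpha>)"

definition monom_eval :: "real ^ 'n \<Rightarrow> nat ^ 'n::finite \<Rightarrow> real" where
  "monom_eval v \<alpha> = (\<Prod>i\<in>UNIV. (v $ i) ^ (\<alpha> $ i))"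

definition var :: "'n \<Rightarrow> 'n::finite rpoly" where
  "var i = Poly_Mapping.single (axis i 1) 1"

lemma poly_eval_eq_coeff_sum: "poly_eval f v = coeff_sum (monom_eval v) f"
  by (simp add: poly_eval_def coeff_sum_def monom_eval_def)

lemma coeff_sum_superset:
  assumes "finite K" "Poly_Mapping.keys f \<subseteq> K"
  shows "coeff_sum \<phi> f = (\<Sum>\<alpha>\<in>K. Poly_Mapping.lookup f \<alpha> * \<phi> \<alpha>)"
  unfolding coeff_sum_def
  by (rule sum.mono_neutral_left) (use assms in \<open>auto simp: in_keys_iff\<close>)

lemma coeff_sum_zero [simp]: "coeff_sum \<phi> 0 = 0"
  by (simp add: coeff_sum_def)

lemma coeff_sum_single [simp]: "coeff_sum \<phi> (Poly_Mapping.single \<alpha> c) = c * \<phi> \<alpha>"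
  by (cases "c = 0") (auto simp: coeff_sum_def)

lemma coeff_sum_add [simp]: "coeff_sum \<phi> (f + g) = coeff_sum \<phi> f + coeff_sum \<phi> g"
proof -
  let ?K = "Poly_Mapping.keys f \<union> Poly_Mapping.keys g"
  have "coeff_sum \<phi> (f + g) = (\<Sum>\<alpha>\<in>?K. Poly_Mapping.lookup (f + g) \<alpha> * \<phi> \<alpha>)"
    by (rule coeff_sum_superset) (auto simp: Poly_Mapping.keys_add)
  also have "\<dots> = (\<Sum>\<alpha>\<in>?K. Poly_Mapping.lookup f \<alpha> * \<phi> \<alpha>) + (\<Sum>\<alpha>\<in>?K. Poly_Mapping.lookup g \<alpha> * \<phi> \<alpha>)"
    by (simp add: lookup_add algebra_simps sum.distrib)
  also have "\<dots> = coeff_sum \<phi> f + coeff_sum \<phi> g"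
    by (subst (1 2) coeff_sum_superset[of ?K]) auto
  finally show ?thesis .
qed

lemma coeff_sum_uminus [simp]: "coeff_sum \<phi> (- f) = - coeff_sum \<phi> f"
  using coeff_sum_add[of \<phi> f "- f"] by simp

lemma coeff_sum_diff [simp]: "coeff_sum \<phi> (f - g) = coeff_sum \<phi> f - coeff_sum \<phi> g"
  using coeff_sum_add[of \<phi> f "- g"] by simp

lemma coeff_sum_sum: "coeff_sum \<phi> (sum F I) = (\<Sum>i\<in>I. coeff_sum \<phi> (F i))"
  by (induction I rule: infinite_finite_induct) auto

lemma coeff_sum_sum_list: "coeff_sum \<phi> (sum_list fs) = (\<Sum>f\<leftarrow>fs. coeff_sum \<phi> f)"
  by (induction fs) auto

lemma sum_single_lookup:
  "(\<Sum>\<alpha>\<in>Poly_Mapping.keys f. Poly_Mapping.single \<alpha> (Poly_Mapping.lookup f \<alpha>)) = f"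
  by (rule poly_mapping_eqI)
     (auto simp: lookup_sum lookup_single when_def in_keys_iff sum.delta cong: if_cong)

lemma coeff_sum_mult:
  "coeff_sum \<phi> (f * g) = (\<Sum>\<alpha>\<in>Poly_Mapping.keys f. \<Sum>\<beta>\<in>Poly_Mapping.keys g.
     Poly_Mapping.lookup f \<alpha> * Poly_Mapping.lookup g \<beta> * \<phi> (\<alpha> + \<beta>))"
proof -
  have "f * g = (\<Sum>\<alpha>\<in>Poly_Mapping.keys f. Poly_Mapping.single \<alpha> (Poly_Mapping.lookup f \<alpha>)) *
                (\<Sum>\<beta>\<in>Poly_Mapping.keys g. Poly_Mapping.single \<beta> (Poly_Mapping.lookup g \<beta>))"
    by (simp only: sum_single_lookup)
  also have "\<dots> = (\<Sum>\<alpha>\<in>Poly_Mapping.keys f. \<Sum>\<beta>\<in>Poly_Mapping.keys g.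
      Poly_Mapping.single (\<alpha> + \<beta>) (Poly_Mapping.lookup f \<alpha> * Poly_Mapping.lookup g \<beta>))"
    by (simp add: sum_product mult_single)
  finally have eq: "f * g = \<dots>" .
  show ?thesis by (subst eq) (simp add: coeff_sum_sum)
qed

lemma lookup_eq_coeff_sum:
  "Poly_Mapping.lookup f \<delta> = coeff_sum (\<lambda>\<alpha>. if \<alpha> = \<delta> then 1 else 0) f"
  by (auto simp: coeff_sum_def in_keys_iff if_distrib sum.delta cong: if_cong)

lemma monom_eval_add: "monom_eval v (\<alpha> + \<beta>) = monom_eval v \<alpha> * monom_eval v \<beta>"
  by (simp add: monom_eval_def power_add prod.distrib)

lemma monom_eval_axis: "monom_eval v (axis i a) = v $ i ^ a"
proof -
  have "monom_eval v (axis i a) = (\<Prod>j\<in>UNIV. if j = i then v $ i ^ a else 1)"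
    unfolding monom_eval_def by (intro prod.cong) (auto simp: axis_def)
  then show ?thesis by simp
qed

lemma poly_eval_zero [simp]: "poly_eval 0 v = 0"
  and poly_eval_add [simp]: "poly_eval (f + g) v = poly_eval f v + poly_eval g v"
  and poly_eval_diff [simp]: "poly_eval (f - g) v = poly_eval f v - poly_eval g v"
  and poly_eval_single: "poly_eval (Poly_Mapping.single \<alpha> c) v = c * monom_eval v \<alpha>"
  and poly_eval_sum_list: "poly_eval (sum_list fs) v = (\<Sum>f\<leftarrow>fs. poly_eval f v)"
  by (simp_all add: poly_eval_eq_coeff_sum coeff_sum_sum_list)

lemma poly_eval_mult [simp]: "poly_eval (f * g) v = poly_eval f v * poly_eval g v"
  by (simp add: poly_eval_eq_coeff_sum coeff_sum_mult monom_eval_add)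
     (simp add: coeff_sum_def sum_product mult_ac)

lemma poly_eval_one [simp]: "poly_eval 1 v = 1"
proof -
  have "poly_eval 1 v = poly_eval (Poly_Mapping.single 0 1) v" by simp
  then show ?thesis by (simp add: poly_eval_single monom_eval_def del: single_one)
qed

lemma poly_eval_numeral [simp]: "poly_eval (numeral k) v = numeral k"
proof -
  have "poly_eval (of_nat m) v = of_nat m" for m
    by (induction m) auto
  from this[of "numeral k"] show ?thesis by simp
qed

lemma poly_eval_var [simp]: "poly_eval (var i) v = v $ i"
  by (simp add: var_def poly_eval_single monom_eval_axis)

section \<open>Homogeneous forms and the inclusions between the cones\<close>

lemma forms_zero: "0 \<in> forms k"
  by (simp add: forms_def)

lemma forms_add: "f \<in> forms k \<Longrightarrow> g \<in> forms k \<Longrightarrow> f + g \<in> forms k"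
  using Poly_Mapping.keys_add[of f g] by (auto simp: forms_def)

lemma forms_uminus: "f \<in> forms k \<Longrightarrow> - f \<in> forms k"
  by (auto simp: forms_def in_keys_iff)

lemma forms_diff: "f \<in> forms k \<Longrightarrow> g \<in> forms k \<Longrightarrow> f - g \<in> forms k"
  using forms_add[of f k "- g"] forms_uminus[of g k] by simp

lemma forms_sum_list: "(\<And>f. f \<in> set fs \<Longrightarrow> f \<in> forms k) \<Longrightarrow> sum_list fs \<in> forms k"
  by (induction fs) (auto simp: forms_zero forms_add)

lemma forms_mult: "f \<in> forms j \<Longrightarrow> g \<in> forms k \<Longrightarrow> f * g \<in> forms (j + k)"
  using Poly_Mapping.keys_mult[of f g] by (fastforce simp: forms_def sum.distrib)

lemma forms_single: "(\<Sum>i\<in>UNIV. \<alpha> $ i) = k \<Longrightarrow> Poly_Mapping.single \<alpha> c \<in> forms k"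
  by (auto simp: forms_def)

lemma sum_axis: "(\<Sum>i\<in>UNIV. axis j a $ i) = (a::nat)"
  by (simp add: axis_def)

lemma forms_var: "var i \<in> forms 1"
  unfolding var_def by (intro forms_single) (simp add: sum_axis)

lemma forms_numeral_mult: "f \<in> forms k \<Longrightarrow> numeral m * f \<in> forms k"
  using forms_mult[of "numeral m" 0 f k] forms_single[of 0 0 "numeral m"] by simp

lemma sos_formsI: "set gs \<subseteq> forms d \<Longrightarrow> f = (\<Sum>g\<leftarrow>gs. g * g) \<Longrightarrow> f \<in> sos_forms d"
  by (auto simp: sos_forms_def)

lemma sos_forms_zero: "0 \<in> sos_forms d"
  by (rule sos_formsI[of "[]"]) auto

lemma sonc_forms_zero: "0 \<in> sonc_forms d"
  by (auto simp: sonc_forms_def intro!: exI[of _ "[]"])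

lemma sos_forms_square: "g \<in> forms d \<Longrightarrow> g * g \<in> sos_forms d"
  by (rule sos_formsI[of "[g]"]) auto

lemma sonc_forms_circuit: "c \<in> nonneg_circuits d \<Longrightarrow> c \<in> sonc_forms d"
  by (auto simp: sonc_forms_def intro!: exI[of _ "[c]"])

lemma sos_subset_sos_plus_sonc: "sos_forms d \<subseteq> sos_plus_sonc_forms d"
  and sonc_subset_sos_plus_sonc: "sonc_forms d \<subseteq> sos_plus_sonc_forms d"
proof -
  show "sos_forms d \<subseteq> sos_plus_sonc_forms d"
    unfolding sos_plus_sonc_forms_def using sonc_forms_zero by (force intro: add_0_right[symmetric])
  show "sonc_forms d \<subseteq> sos_plus_sonc_forms d"
    unfolding sos_plus_sonc_forms_def using sos_forms_zero by (force intro: add_0_left[symmetric])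
qed

lemma sos_subset_psd: "sos_forms d \<subseteq> psd_forms d"
proof
  fix f :: "'n::finite rpoly" assume "f \<in> sos_forms d"
  then obtain gs where gs: "set gs \<subseteq> forms d" "f = (\<Sum>g\<leftarrow>gs. g * g)"
    by (auto simp: sos_forms_def)
  have "g * g \<in> forms (2 * d)" if "g \<in> set gs" for g
    using forms_mult[of g d g d] gs(1) that by (auto simp: mult_2)
  then have "f \<in> forms (2 * d)"
    unfolding gs(2) by (intro forms_sum_list) auto
  moreover have "poly_eval f v \<ge> 0" for v
    unfolding gs(2) poly_eval_sum_list by (intro sum_list_nonneg) auto
  ultimately show "f \<in> psd_forms d" by (simp add: psd_forms_def)
qed

lemma sonc_subset_psd: "sonc_forms d \<subseteq> psd_forms d"
proof
  fix f :: "'n::finite rpoly" assume "f \<in> sonc_forms d"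
  then obtain cs where cs: "set cs \<subseteq> psd_forms d" "f = sum_list cs"
    by (auto simp: sonc_forms_def nonneg_circuits_def)
  have "f \<in> forms (2 * d)"
    unfolding cs(2) using cs(1) by (intro forms_sum_list) (auto simp: psd_forms_def)
  moreover have "poly_eval f v \<ge> 0" for v
    unfolding cs(2) poly_eval_sum_list using cs(1)
    by (intro sum_list_nonneg) (auto simp: psd_forms_def)
  ultimately show "f \<in> psd_forms d" by (simp add: psd_forms_def)
qed

lemma sos_plus_sonc_subset_psd: "sos_plus_sonc_forms d \<subseteq> psd_forms d"
proof
  fix f :: "'n::finite rpoly" assume "f \<in> sos_plus_sonc_forms d"
  then obtain g h where "f = g + h" "g \<in> psd_forms d" "h \<in> psd_forms d"
    using sos_subset_psd sonc_subset_psd by (force simp: sos_plus_sonc_forms_def)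
  then show "f \<in> psd_forms d" by (auto simp: psd_forms_def forms_add)
qed

lemma poly_eval_sos_ge_square:
  assumes "g \<in> set gs"
  shows "(poly_eval g v)\<^sup>2 \<le> poly_eval (\<Sum>g\<leftarrow>gs. g * g) v"
proof -
  have "poly_eval (g * g) v \<le> (\<Sum>p\<leftarrow>map (\<lambda>g. g * g) gs. poly_eval p v)"
    by (rule member_le_sum_list) (use assms in auto)
  then show ?thesis by (simp add: poly_eval_sum_list power2_eq_square)
qed

text \<open>All summands of a decomposition are nonnegative, so each is bounded by \<open>f\<close>,
  and conditions on single squares and circuits suffice. Applied at a point \<open>e\<close> where
  \<open>f\<close> is positive, this excludes a decomposition.\<close>

lemma sos_plus_sonc_eval_eq_zero:
  assumes "f \<in> sos_plus_sonc_forms d"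
    and sq: "\<And>g. g \<in> forms d \<Longrightarrow> (\<And>v. (poly_eval g v)\<^sup>2 \<le> poly_eval f v) \<Longrightarrow> poly_eval g e = 0"
    and circ: "\<And>c. c \<in> nonneg_circuits d \<Longrightarrow> (\<And>v. poly_eval c v \<le> poly_eval f v) \<Longrightarrow> poly_eval c e = 0"
  shows "poly_eval f e = 0"
proof -
  obtain gs cs where gs: "set gs \<subseteq> forms d" and cs: "set cs \<subseteq> nonneg_circuits d"
    and f: "f = (\<Sum>g\<leftarrow>gs. g * g) + sum_list cs"
    using assms(1) by (auto simp: sos_plus_sonc_forms_def sos_forms_def sonc_forms_def)
  have sos_nonneg: "poly_eval (\<Sum>g\<leftarrow>gs. g * g) v \<ge> 0" for v
    unfolding poly_eval_sum_list by (intro sum_list_nonneg) auto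
  have cs_nonneg: "poly_eval c v \<ge> 0" if "c \<in> set cs" for c v
    using cs that by (auto simp: nonneg_circuits_def psd_forms_def)
  have sonc_nonneg: "poly_eval (sum_list cs) v \<ge> 0" for v
    unfolding poly_eval_sum_list using cs_nonneg by (intro sum_list_nonneg) auto
  have "poly_eval g e = 0" if g: "g \<in> set gs" for g
  proof (rule sq)
    show "(poly_eval g v)\<^sup>2 \<le> poly_eval f v" for v
      using poly_eval_sos_ge_square[OF g, of v] sonc_nonneg[of v] by (simp add: f)
  qed (use g gs in auto)
  then have sos0: "poly_eval (\<Sum>g\<leftarrow>gs. g * g) e = 0"
    by (induction gs) auto
  have "poly_eval c e = 0" if c: "c \<in> set cs" for c
  proof (rule circ)
    show "poly_eval c v \<le> poly_eval f v" for v
    proof -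
      have "poly_eval c v \<le> poly_eval (sum_list cs) v"
        unfolding poly_eval_sum_list
        by (rule member_le_sum_list) (use c cs_nonneg in auto)
      then show ?thesis using sos_nonneg[of v] by (simp add: f)
    qed
  qed (use c cs in auto)
  then have "poly_eval (sum_list cs) e = 0"
    by (induction cs) auto
  with sos0 show ?thesis by (simp add: f)
qed

section \<open>Necessary conditions\<close>

lemma exp_mult_neg_tendsto_zero:
  assumes "c < (0::real)"
  shows "((\<lambda>s. exp (s * c)) \<longlongrightarrow> 0) at_top"
proof -
  have "LIM s at_top. s * c :> at_bot"
    using filterlim_tendsto_neg_mult_at_bot[OF tendsto_const assms filterlim_ident]
    by (simp add: mult.commute)
  then show ?thesis by (rule filterlim_compose[OF exp_at_bot])
qed

lemma monom_eval_exp: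
  "monom_eval (\<chi> i. exp (s * u $ i)) \<alpha> = exp (s * (u \<bullet> real_exponent \<alpha>))"
  by (simp add: monom_eval_def real_exponent_def inner_vec_def exp_sum sum_distrib_left
      flip: exp_of_nat_mult) (simp add: mult_ac)

text \<open>The weight \<open>w\<close> is perturbed so that it separates the exponents of \<open>g\<close>. Along the curve
  \<open>s \<mapsto> (exp (s u\<^sub>i))\<^sub>i\<close> the form \<open>g\<close> is then governed by a single term, which cannot cancel.\<close>

lemma keys_weight_le:
  fixes w :: "real ^ 'n::finite"
  assumes dom: "\<And>v. (poly_eval g v)\<^sup>2 \<le> poly_eval f v"
    and f: "\<And>\<alpha>. \<alpha> \<in> Poly_Mapping.keys f \<Longrightarrow> w \<bullet> real_exponent \<alpha> \<le> 2 * B"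
    and \<gamma>: "\<gamma> \<in> Poly_Mapping.keys g"
  shows "w \<bullet> real_exponent \<gamma> \<le> B"
proof (rule ccontr)
  assume "\<not> w \<bullet> real_exponent \<gamma> \<le> B"
  then have w: "(real_exponent \<alpha> - 2 *\<^sub>R real_exponent \<gamma>) \<bullet> w < 0" if "\<alpha> \<in> Poly_Mapping.keys f" for \<alpha>
    using f[OF that] by (simp add: inner_diff_right inner_commute[of _ w])
  \<comment> \<open>\<open>U\<close> is an open neighbourhood of \<open>w\<close> in which twice the
    weight of \<gamma> still exceeds every weight of \<open>f\<close>. \<open>N\<close> collects the
    hyperplanes on which two exponents of \<open>g\<close> tie; it is a null set, so it cannot cover
    \<open>U\<close>.\<close>
  define U where "U = (\<Inter>\<alpha>\<in>Poly_Mapping.keys f. {u. (real_exponent \<alpha> - 2 *\<^sub>R real_exponent \<gamma>) \<bullet> u < 0})"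
  define N where "N = (\<Union>(\<alpha>, \<beta>)\<in>{(\<alpha>, \<beta>) \<in> Poly_Mapping.keys g \<times> Poly_Mapping.keys g. \<alpha> \<noteq> \<beta>}.
      {u. (real_exponent \<alpha> - real_exponent \<beta>) \<bullet> u = 0})"
  have inj: "real_exponent \<alpha> \<noteq> real_exponent \<beta>" if "\<alpha> \<noteq> \<beta>" for \<alpha> \<beta> :: "nat ^ 'n"
    using that by (auto simp: real_exponent_def vec_eq_iff)
  have "open U"
    unfolding U_def by (intro open_INT ballI open_halfspace_lt) auto
  moreover have "w \<in> U" using w by (auto simp: U_def)
  ultimately have "\<not> negligible U" using open_not_negligible by blast
  moreover have "negligible N"
  proof -
    have "finite {(\<alpha>, \<beta>) \<in> Poly_Mapping.keys g \<times> Poly_Mapping.keys g. \<alpha> \<noteq> \<beta>}"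
      by (rule finite_subset[of _ "Poly_Mapping.keys g \<times> Poly_Mapping.keys g"]) auto
    then show ?thesis
      unfolding N_def using inj by (intro negligible_Union finite_imageI) (auto intro!: negligible_hyperplane)
  qed
  ultimately obtain u where u: "u \<in> U" "u \<notin> N"
    using negligible_subset by blast
  have "\<exists>\<alpha>\<in>Poly_Mapping.keys g. \<forall>\<beta>\<in>Poly_Mapping.keys g. u \<bullet> real_exponent \<beta> \<le> u \<bullet> real_exponent \<alpha>"
  proof -
    let ?M = "(\<lambda>\<alpha>. u \<bullet> real_exponent \<alpha>) ` Poly_Mapping.keys g"
    have "Max ?M \<in> ?M" using \<gamma> by (intro Max_in) auto
    then obtain \<alpha> where "\<alpha> \<in> Poly_Mapping.keys g" "Max ?M = u \<bullet> real_exponent \<alpha>" by auto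
    then show ?thesis by (metis Max_ge finite_imageI finite_keys imageI)
  qed
  then obtain \<alpha> where \<alpha>: "\<alpha> \<in> Poly_Mapping.keys g"
    and max: "\<And>\<beta>. \<beta> \<in> Poly_Mapping.keys g \<Longrightarrow> u \<bullet> real_exponent \<beta> \<le> u \<bullet> real_exponent \<alpha>" by blast
  \<comment> \<open>Scaling by \<open>exp (- (s * m))\<close> makes the top term of \<open>g\<close>
    constant and lets its other terms decay. The square of this factor makes all of \<open>f\<close>
    decay, because every weight of \<open>f\<close> is below twice that of \<gamma>, hence below
    \<open>2 * m\<close>.\<close>
  define m where "m = u \<bullet> real_exponent \<alpha>"
  have g_less: "u \<bullet> real_exponent \<beta> - m < 0" if "\<beta> \<in> Poly_Mapping.keys g" "\<beta> \<noteq> \<alpha>" for \<beta>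
  proof -
    have "(real_exponent \<beta> - real_exponent \<alpha>) \<bullet> u \<noteq> 0"
      using u(2) that \<alpha> by (auto simp: N_def)
    then show ?thesis using max[OF that(1)] by (simp add: m_def inner_diff_right inner_commute)
  qed
  have f_less: "u \<bullet> real_exponent \<beta> - 2 * m < 0" if "\<beta> \<in> Poly_Mapping.keys f" for \<beta>
    using u(1) that max[OF \<gamma>] by (force simp: U_def m_def inner_diff_right inner_commute)
  define v where "v s = (\<chi> i. exp (s * u $ i))" for s
  have "((\<lambda>s. \<Sum>\<beta>\<in>Poly_Mapping.keys g. Poly_Mapping.lookup g \<beta> * exp (s * (u \<bullet> real_exponent \<beta> - m)))
      \<longlongrightarrow> (\<Sum>\<beta>\<in>Poly_Mapping.keys g. if \<beta> = \<alpha> then Poly_Mapping.lookup g \<alpha> else 0)) at_top"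
  proof (intro tendsto_sum)
    fix \<beta> assume "\<beta> \<in> Poly_Mapping.keys g"
    then show "((\<lambda>s. Poly_Mapping.lookup g \<beta> * exp (s * (u \<bullet> real_exponent \<beta> - m)))
      \<longlongrightarrow> (if \<beta> = \<alpha> then Poly_Mapping.lookup g \<alpha> else 0)) at_top"
      using tendsto_mult_right_zero[OF exp_mult_neg_tendsto_zero[OF g_less]]
      by (cases "\<beta> = \<alpha>") (auto simp: m_def)
  qed
  moreover have "(\<Sum>\<beta>\<in>Poly_Mapping.keys g. Poly_Mapping.lookup g \<beta> * exp (s * (u \<bullet> real_exponent \<beta> - m)))
      = exp (- (s * m)) * poly_eval g (v s)" for s
    by (simp add: poly_eval_eq_coeff_sum coeff_sum_def v_def monom_eval_exp sum_distrib_left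
        right_diff_distrib exp_diff exp_minus field_simps)
  ultimately have "((\<lambda>s. exp (- (s * m)) * poly_eval g (v s)) \<longlongrightarrow> Poly_Mapping.lookup g \<alpha>) at_top"
    using \<alpha> by simp
  from tendsto_power[OF this, of 2]
  have lim_g: "((\<lambda>s. (exp (- (s * m)) * poly_eval g (v s))\<^sup>2) \<longlongrightarrow> (Poly_Mapping.lookup g \<alpha>)\<^sup>2) at_top" .
  have "((\<lambda>s. \<Sum>\<beta>\<in>Poly_Mapping.keys f. Poly_Mapping.lookup f \<beta> * exp (s * (u \<bullet> real_exponent \<beta> - 2 * m)))
      \<longlongrightarrow> 0) at_top"
    by (intro tendsto_null_sum tendsto_mult_right_zero exp_mult_neg_tendsto_zero f_less)
  moreover have "(\<Sum>\<beta>\<in>Poly_Mapping.keys f. Poly_Mapping.lookup f \<beta> * exp (s * (u \<bullet> real_exponent \<beta> - 2 * m)))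
      = (exp (- (s * m)))\<^sup>2 * poly_eval f (v s)" for s
  proof -
    have "(exp (- (s * m)))\<^sup>2 = exp (- (s * (2 * m)))"
      by (simp add: power2_eq_square flip: exp_add)
    then show ?thesis
      by (simp add: poly_eval_eq_coeff_sum coeff_sum_def v_def monom_eval_exp sum_distrib_left
        right_diff_distrib exp_diff exp_minus field_simps)
  qed
  ultimately have lim_f: "((\<lambda>s. (exp (- (s * m)))\<^sup>2 * poly_eval f (v s)) \<longlongrightarrow> 0) at_top"
    by simp
  \<comment> \<open>The domination of \<open>g\<close> squared by \<open>f\<close> survives the
    scaling and passes to the limit.\<close>
  have "(Poly_Mapping.lookup g \<alpha>)\<^sup>2 \<le> 0"
    by (rule tendsto_le[OF _ lim_f lim_g])
       (auto simp: power_mult_distrib intro!: always_eventually mult_left_mono dom)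
  then show False using \<alpha> by (simp add: in_keys_iff)
qed

section \<open>Coefficients and zeros of circuits and sums of squares\<close>

lemma circuit_inner_unique:
  assumes "is_circuit c" "\<alpha> \<in> inner_supp c" "\<beta> \<in> inner_supp c"
  shows "\<alpha> = \<beta>"
  using assms by (auto simp: is_circuit_def)

text \<open>The sum dominates the value of \<open>c\<close> at some vector of signs. Changing the
  sign of one variable is enough, since a circuit has at most one inner exponent and all its other
  terms are even.\<close>

lemma circuit_coeff_sum_nonneg:
  assumes c: "c \<in> nonneg_circuits d"
    and even: "\<And>\<alpha>. (\<And>i. even (\<alpha> $ i)) \<Longrightarrow> \<sigma> \<alpha> = 1" and le: "\<And>\<alpha>. \<bar>\<sigma> \<alpha>\<bar> \<le> 1"
  shows "coeff_sum \<sigma> c \<ge> 0"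
proof -
  \<comment> \<open>A sign vector turns the inner term, if it is not even, into minus its absolute value.\<close>
  have "\<exists>v. \<forall>\<alpha>\<in>Poly_Mapping.keys c. Poly_Mapping.lookup c \<alpha> * monom_eval v \<alpha> \<le> Poly_Mapping.lookup c \<alpha> * \<sigma> \<alpha>"
  proof (cases "\<forall>\<alpha>\<in>Poly_Mapping.keys c. \<forall>i. even (\<alpha> $ i)")
    case True
    then show ?thesis using even by (intro exI[of _ "\<chi> i. 1"]) (auto simp: monom_eval_def)
  next
    case False
    then obtain \<beta> i where \<beta>: "\<beta> \<in> Poly_Mapping.keys c" "odd (\<beta> $ i)" by auto
    define \<tau> where "\<tau> = - sgn (Poly_Mapping.lookup c \<beta>)"
    define v where "v = (\<chi> j. if j = i then \<tau> else 1)"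
    have \<tau>: "\<tau> = 1 \<or> \<tau> = -1"
      using \<beta> by (auto simp: \<tau>_def sgn_if in_keys_iff)
    have v: "monom_eval v \<alpha> = \<tau> ^ (\<alpha> $ i)" for \<alpha>
    proof -
      have "monom_eval v \<alpha> = (\<Prod>j\<in>UNIV. if j = i then \<tau> ^ (\<alpha> $ i) else 1)"
        unfolding monom_eval_def by (intro prod.cong) (auto simp: v_def)
      then show ?thesis by simp
    qed
    have "Poly_Mapping.lookup c \<alpha> * monom_eval v \<alpha> \<le> Poly_Mapping.lookup c \<alpha> * \<sigma> \<alpha>"
      if \<alpha>: "\<alpha> \<in> Poly_Mapping.keys c" for \<alpha>
    proof (cases "\<alpha> = \<beta>")
      case True
      have "\<tau> ^ (\<beta> $ i) = \<tau>" using \<tau> \<beta>(2) by auto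
      then have "Poly_Mapping.lookup c \<beta> * monom_eval v \<beta> = - \<bar>Poly_Mapping.lookup c \<beta>\<bar>"
        unfolding v by (simp add: \<tau>_def abs_sgn)
      also have "\<dots> \<le> - \<bar>Poly_Mapping.lookup c \<beta> * \<sigma> \<beta>\<bar>"
        using le[of \<beta>] by (simp add: abs_mult mult_left_le)
      also have "\<dots> \<le> Poly_Mapping.lookup c \<beta> * \<sigma> \<beta>" by simp
      finally show ?thesis using True by simp
    next
      case False
      have "\<beta> \<in> inner_supp c" using \<beta> by (auto simp: inner_supp_def square_supp_def)
      then have "\<alpha> \<notin> inner_supp c"
        using False c circuit_inner_unique by (auto simp: nonneg_circuits_def)
      then have "even (\<alpha> $ j)" for j using \<alpha> by (auto simp: inner_supp_def square_supp_def)
      then show ?thesis using \<tau> even[of \<alpha>] by (auto simp: v)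
    qed
    then show ?thesis by blast
  qed
  then obtain v where "poly_eval c v \<le> coeff_sum \<sigma> c"
    unfolding poly_eval_eq_coeff_sum coeff_sum_def by (meson sum_mono)
  moreover have "0 \<le> poly_eval c v" using c by (auto simp: nonneg_circuits_def psd_forms_def)
  ultimately show ?thesis by linarith
qed

lemma sonc_coeff_sum_nonneg:
  assumes "f \<in> sonc_forms d"
    and "\<And>\<alpha>. (\<And>i. even (\<alpha> $ i)) \<Longrightarrow> \<sigma> \<alpha> = 1" and "\<And>\<alpha>. \<bar>\<sigma> \<alpha>\<bar> \<le> 1"
  shows "coeff_sum \<sigma> f \<ge> 0"
proof -
  obtain cs where cs: "set cs \<subseteq> nonneg_circuits d" "f = sum_list cs"
    using assms(1) by (auto simp: sonc_forms_def)
  have "coeff_sum \<sigma> c \<ge> 0" if "c \<in> set cs" for c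
    by (rule circuit_coeff_sum_nonneg[of c d]) (use that cs assms in auto)
  then show ?thesis by (auto simp: cs(2) coeff_sum_sum_list intro!: sum_list_nonneg)
qed

text \<open>The coefficient of \<open>g * g\<close> at \<delta> collects the products over pairs of
  exponents with sum \<delta>. Under \<open>K\<close> only a pair of equal exponents can occur,
  which contributes the square of a coefficient.\<close>

lemma sos_lookup_nonneg:
  assumes "f \<in> sos_forms d"
    and K: "\<And>g \<alpha> \<beta>. \<lbrakk>g \<in> forms d; \<And>v. (poly_eval g v)\<^sup>2 \<le> poly_eval f v; \<alpha> \<in> Poly_Mapping.keys g;
      \<beta> \<in> Poly_Mapping.keys g; \<alpha> + \<beta> = \<delta>\<rbrakk> \<Longrightarrow> \<alpha> = \<beta>"
  shows "Poly_Mapping.lookup f \<delta> \<ge> 0"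
proof -
  obtain gs where gs: "set gs \<subseteq> forms d" and f: "f = (\<Sum>g\<leftarrow>gs. g * g)"
    using assms(1) by (auto simp: sos_forms_def)
  have "coeff_sum (\<lambda>\<alpha>. if \<alpha> = \<delta> then 1 else 0) (g * g) \<ge> 0" if g: "g \<in> set gs" for g
    unfolding coeff_sum_mult
  proof (intro sum_nonneg)
    fix \<alpha> \<beta> assume *: "\<alpha> \<in> Poly_Mapping.keys g" "\<beta> \<in> Poly_Mapping.keys g"
    show "0 \<le> Poly_Mapping.lookup g \<alpha> * Poly_Mapping.lookup g \<beta> * (if \<alpha> + \<beta> = \<delta> then 1 else 0)"
      using K[of g \<alpha> \<beta>] * g gs poly_eval_sos_ge_square[OF g] by (auto simp: f)
  qed
  then show ?thesis
    by (auto simp: lookup_eq_coeff_sum f coeff_sum_sum_list intro!: sum_list_nonneg)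
qed

text \<open>Makes the value of a form at the indicator of \<open>T\<close> the sum of its
  coefficients on exponents supported in \<open>T\<close>, so that zeros at such points restrict the
  support.\<close>

lemma monom_eval_indicator:
  "monom_eval (\<chi> i. of_bool (i \<in> T)) \<alpha> = of_bool (\<forall>i. \<alpha> $ i \<noteq> 0 \<longrightarrow> i \<in> T)"
proof (cases "\<forall>i. \<alpha> $ i \<noteq> 0 \<longrightarrow> i \<in> T")
  case True
  then have "(of_bool (i \<in> T) :: real) ^ (\<alpha> $ i) = 1" for i
    by (cases "\<alpha> $ i = 0") auto
  then show ?thesis using True by (simp add: monom_eval_def)
next
  case False
  then obtain i where "\<alpha> $ i \<noteq> 0" "i \<notin> T" by auto
  then have "monom_eval (\<chi> i. of_bool (i \<in> T)) \<alpha> = 0"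
    unfolding monom_eval_def by (intro prod_zero) (auto intro!: bexI[of _ i])
  then show ?thesis using False by simp
qed

lemma form_key_axis:
  assumes "c \<in> forms k" "\<alpha> \<in> Poly_Mapping.keys c" "\<And>i. \<alpha> $ i \<noteq> 0 \<Longrightarrow> i = z"
  shows "\<alpha> = axis z k"
proof -
  have "k = (\<Sum>i\<in>UNIV. \<alpha> $ i)" using assms by (auto simp: forms_def)
  also have "\<dots> = (\<Sum>i\<in>{z}. \<alpha> $ i)"
    by (rule sum.mono_neutral_right) (use assms(3) in auto)
  finally have "\<alpha> $ z = k" by simp
  moreover have "\<alpha> $ i = 0" if "i \<noteq> z" for i
    using assms(3) that by blast
  ultimately show ?thesis by (simp add: vec_eq_iff axis_def)
qed

text \<open>If the vertex on the \<open>z\<close>-axis occurs in \<open>c\<close>, then both zeros need a compensating negative term.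
  There is only one inner exponent, so it would have to lie on the \<open>z\<close>-axis as well.\<close>

lemma circuit_eval_axis_eq_zero:
  fixes c :: "'n::finite rpoly"
  assumes c: "c \<in> nonneg_circuits d" and T: "T1 \<inter> T2 = {z}"
    and zero: "poly_eval c (\<chi> i. of_bool (i \<in> T1)) = 0" "poly_eval c (\<chi> i. of_bool (i \<in> T2)) = 0"
  shows "poly_eval c (\<chi> i. of_bool (i = z)) = 0"
proof (rule ccontr)
  assume nz: "poly_eval c (\<chi> i. of_bool (i = z)) \<noteq> 0"
  have circ: "is_circuit c" and form: "c \<in> forms (2 * d)" and psd: "\<And>v. poly_eval c v \<ge> 0"
    using c by (auto simp: nonneg_circuits_def psd_forms_def)
  let ?\<delta> = "axis z (2 * d)"
  have "poly_eval c (\<chi> i. of_bool (i \<in> {z})) =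
      (\<Sum>\<alpha>\<in>Poly_Mapping.keys c. if \<alpha> = ?\<delta> then Poly_Mapping.lookup c ?\<delta> else 0)"
    unfolding poly_eval_eq_coeff_sum coeff_sum_def monom_eval_indicator
    by (intro sum.cong) (use form_key_axis[OF form] in \<open>auto simp: axis_def split: if_splits\<close>)
  also have "\<dots> = Poly_Mapping.lookup c ?\<delta>"
    by (auto simp: in_keys_iff)
  finally have pos: "Poly_Mapping.lookup c ?\<delta> > 0"
    using nz psd[of "\<chi> i. of_bool (i = z)"] by simp
  then have \<delta>: "?\<delta> \<in> square_supp c" by (auto simp: square_supp_def in_keys_iff axis_def)
  have inner: "\<exists>\<beta>\<in>inner_supp c. \<forall>i. \<beta> $ i \<noteq> 0 \<longrightarrow> i \<in> T"
    if T: "z \<in> T" and 0: "poly_eval c (\<chi> i. of_bool (i \<in> T)) = 0" for T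
  proof (rule ccontr)
    assume neg: "\<not> ?thesis"
    have "0 < (\<Sum>\<alpha>\<in>Poly_Mapping.keys c. Poly_Mapping.lookup c \<alpha> * monom_eval (\<chi> i. of_bool (i \<in> T)) \<alpha>)"
    proof (rule sum_pos2)
      show "0 < Poly_Mapping.lookup c ?\<delta> * monom_eval (\<chi> i. of_bool (i \<in> T)) ?\<delta>"
        using pos T by (auto simp: monom_eval_indicator axis_def)
      show "0 \<le> Poly_Mapping.lookup c \<alpha> * monom_eval (\<chi> i. of_bool (i \<in> T)) \<alpha>"
        if "\<alpha> \<in> Poly_Mapping.keys c" for \<alpha>
      proof (cases "\<alpha> \<in> inner_supp c")
        case True
        then show ?thesis using neg by (auto simp: monom_eval_indicator)
      next
        case False
        then show ?thesis using that by (simp add: inner_supp_def square_supp_def monom_eval_indicator)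
      qed
    qed (use pos in \<open>auto simp: in_keys_iff\<close>)
    then show False using 0 by (simp add: poly_eval_eq_coeff_sum coeff_sum_def)
  qed
  obtain \<beta>1 where \<beta>1: "\<beta>1 \<in> inner_supp c" "\<And>i. \<beta>1 $ i \<noteq> 0 \<Longrightarrow> i \<in> T1"
    using inner[OF _ zero(1)] T by blast
  obtain \<beta>2 where \<beta>2: "\<beta>2 \<in> inner_supp c" "\<And>i. \<beta>2 $ i \<noteq> 0 \<Longrightarrow> i \<in> T2"
    using inner[OF _ zero(2)] T by blast
  \<comment> \<open>The common exponent is supported in both \<open>T1\<close> and
    \<open>T2\<close>, hence on the \<open>z\<close>-axis. By homogeneity it is
    \<open>?\<delta>\<close>, which belongs to \<open>square_supp c\<close>.\<close>
  have "\<beta>1 = \<beta>2" using circuit_inner_unique circ \<beta>1(1) \<beta>2(1) by blast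
  then have "\<beta>1 = ?\<delta>"
    using \<beta>1 \<beta>2 T by (intro form_key_axis[OF form]) (auto simp: inner_supp_def)
  then show False using \<beta>1(1) \<delta> by (simp add: inner_supp_def)
qed

section \<open>A criterion for circuits, and bounds on exponents term by term\<close>

text \<open>The assumption \<open>indep\<close> is affine independence of \<open>A\<close> in
  coordinates, and \<open>u\<close> gives strictly positive barycentric coordinates of \<beta>. So
  the Newton polytope is the simplex on \<open>A\<close>: its extreme points are exactly
  \<open>A\<close>, and \<beta> lies in its relative interior.\<close>

lemma is_circuitI:
  fixes h :: "'n::finite rpoly"
  assumes keys: "Poly_Mapping.keys h = insert \<beta> A" and "finite A" and "\<beta> \<notin> A"
    and A: "\<And>\<alpha> i. \<alpha> \<in> A \<Longrightarrow> even (\<alpha> $ i)" "\<And>\<alpha>. \<alpha> \<in> A \<Longrightarrow> Poly_Mapping.lookup h \<alpha> > 0"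
    and \<beta>: "Poly_Mapping.lookup h \<beta> < 0"
    and indep: "\<And>u. sum u A = 0 \<Longrightarrow> (\<And>i. (\<Sum>\<alpha>\<in>A. u \<alpha> * real (\<alpha> $ i)) = 0) \<Longrightarrow> \<forall>\<alpha>\<in>A. u \<alpha> = 0"
    and u: "\<And>\<alpha>. \<alpha> \<in> A \<Longrightarrow> u \<alpha> > 0" "sum u A = 1" "\<And>i. (\<Sum>\<alpha>\<in>A. u \<alpha> * real (\<alpha> $ i)) = real (\<beta> $ i)"
  shows "is_circuit h"
proof -
  have inj: "inj (real_exponent :: nat ^ 'n \<Rightarrow> _)"
    by (auto simp: inj_def real_exponent_def vec_eq_iff)
  have comb: "(\<Sum>x\<in>real_exponent ` A. v x *\<^sub>R x) $ i = (\<Sum>\<alpha>\<in>A. v (real_exponent \<alpha>) * real (\<alpha> $ i))" for v i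
    by (simp add: sum.reindex inj_on_subset[OF inj]) (simp add: real_exponent_def)
  have aff: "\<not> affine_dependent (real_exponent ` A)"
  proof
    assume "affine_dependent (real_exponent ` A)"
    then obtain v where v: "sum v (real_exponent ` A) = 0" "\<exists>x\<in>real_exponent ` A. v x \<noteq> 0"
      "(\<Sum>x\<in>real_exponent ` A. v x *\<^sub>R x) = 0"
      using \<open>finite A\<close> by (auto simp: affine_dependent_explicit_finite)
    have "(\<Sum>\<alpha>\<in>A. v (real_exponent \<alpha>) * real (\<alpha> $ i)) = 0" for i
      unfolding comb[symmetric] v(3) by simp
    then have "\<forall>\<alpha>\<in>A. v (real_exponent \<alpha>) = 0"
      using v(1) by (intro indep) (simp_all add: sum.reindex inj_on_subset[OF inj])
    then show False using v(2) by auto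
  qed
  have S: "square_supp h = A"
    using A \<beta> by (auto simp: square_supp_def keys)
  have I: "inner_supp h = {\<beta>}"
    using \<open>\<beta> \<notin> A\<close> by (auto simp: inner_supp_def S keys)
  \<comment> \<open>The weights are indexed by natural exponents; the inverse of the injection
    carries them over to the points in real space.\<close>
  define u' where "u' x = u (inv real_exponent x)" for x
  have u': "u' (real_exponent \<alpha>) = u \<alpha>" for \<alpha>
    by (simp add: u'_def inv_f_f[OF inj])
  have "(\<Sum>x\<in>real_exponent ` A. u' x *\<^sub>R x) = real_exponent \<beta>"
    unfolding vec_eq_iff comb u' u(3) by (simp add: real_exponent_def)
  moreover have "(\<Sum>x\<in>real_exponent ` A. u' x) = 1"
    using u(2) by (simp add: sum.reindex inj_on_subset[OF inj] u')
  ultimately have rel: "real_exponent \<beta> \<in> rel_interior (convex hull (real_exponent ` A))"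
    unfolding rel_interior_convex_hull_explicit[OF aff]
    using u(1) by (intro CollectI exI[of _ u']) (auto simp: u')
  then have "real_exponent \<beta> \<in> convex hull (real_exponent ` A)"
    using rel_interior_subset by blast
  then have hull: "newton_polytope h = convex hull (real_exponent ` A)"
    by (simp add: newton_polytope_def keys hull_redundant)
  then have "newton_vertices h = real_exponent ` A"
    by (simp add: newton_vertices_def extreme_point_of_convex_hull_affine_independent[OF aff])
  then show ?thesis
    using aff rel by (simp add: is_circuit_def S I hull)
qed

text \<open>Cancellation only removes exponents, so a bound on the exponents of a long sum can be
  checked on its terms without computing the support.\<close>

lemma keys_all_add:
  "\<forall>\<alpha>\<in>Poly_Mapping.keys f. P \<alpha> \<Longrightarrow> \<forall>\<alpha>\<in>Poly_Mapping.keys g. P \<alpha> \<Longrightarrow> \<forall>\<alpha>\<in>Poly_Mapping.keys (f + g). P \<alpha>"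
  using Poly_Mapping.keys_add[of f g] by auto

lemma keys_all_single: "P \<alpha> \<Longrightarrow> \<forall>\<beta>\<in>Poly_Mapping.keys (Poly_Mapping.single \<alpha> c). P \<beta>"
  by simp

text \<open>The case of \<open>keys_weight_le\<close> with weight supported on three coordinates,
  used to pass facet inequalities of the Newton polytope of \<open>f\<close> to half of that
  polytope.\<close>

lemma keys_linear_le:
  fixes a b c B :: real
  assumes dom: "\<And>v. (poly_eval g v)\<^sup>2 \<le> poly_eval f v"
    and f: "\<forall>\<alpha>\<in>Poly_Mapping.keys f. a * \<alpha> $ x + b * \<alpha> $ y + c * \<alpha> $ z \<le> 2 * B"
    and \<gamma>: "\<gamma> \<in> Poly_Mapping.keys g"
  shows "a * \<gamma> $ x + b * \<gamma> $ y + c * \<gamma> $ z \<le> B"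
proof -
  have eq: "(axis x a + axis y b + axis z c) \<bullet> real_exponent \<alpha> = a * \<alpha> $ x + b * \<alpha> $ y + c * \<alpha> $ z"
    for \<alpha> :: "nat ^ 'a"
    by (simp add: inner_add_left inner_axis' real_exponent_def)
  show ?thesis
    using keys_weight_le[OF dom _ \<gamma>, of "axis x a + axis y b + axis z c" B] f
    unfolding eq by blast
qed

section \<open>Robinson's forms\<close>

definition mon3 :: "'n \<Rightarrow> 'n \<Rightarrow> 'n \<Rightarrow> nat \<Rightarrow> nat \<Rightarrow> nat \<Rightarrow> nat ^ 'n::finite" where
  "mon3 x y z a b c = axis x a + axis y b + axis z c"

lemma monom_eval_mon3: "monom_eval v (mon3 x y z a b c) = v $ x ^ a * v $ y ^ b * v $ z ^ c"
  by (simp add: mon3_def monom_eval_add monom_eval_axis)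

lemma forms_mon3: "a + b + c = k \<Longrightarrow> Poly_Mapping.single (mon3 x y z a b c) r \<in> forms k"
  by (intro forms_single) (simp add: mon3_def sum.distrib sum_axis)

lemma mon3_nth:
  assumes "x \<noteq> y" "x \<noteq> z" "y \<noteq> z"
  shows "mon3 x y z a b c $ i = (if i = x then a else if i = y then b else if i = z then c else 0)"
  using assms by (simp add: mon3_def axis_def)

definition robinson_sextic :: "'n \<Rightarrow> 'n \<Rightarrow> 'n \<Rightarrow> nat \<Rightarrow> 'n::finite rpoly" where
  "robinson_sextic x y z k = (let t = (\<lambda>a b c. Poly_Mapping.single (mon3 x y z a b (2 * k + c))) in
     t 6 0 0 1 + t 0 6 0 1 + t 0 0 6 1 + t 4 2 0 (-1) + t 4 0 2 (-1) + t 2 4 0 (-1) + t 0 4 2 (-1)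
     + t 2 0 4 (-1) + t 0 2 4 (-1) + t 2 2 2 3)"

lemma poly_eval_robinson_sextic:
  fixes v :: "real ^ 'n::finite" and x y z :: 'n and k :: nat
  defines "X \<equiv> v $ x" and "Y \<equiv> v $ y" and "Z \<equiv> v $ z"
  shows "poly_eval (robinson_sextic x y z k) v = Z ^ (2 * k) * (X ^ 6 + Y ^ 6 + Z ^ 6 - X ^ 4 * Y ^ 2
    - X ^ 4 * Z ^ 2 - X ^ 2 * Y ^ 4 - Y ^ 4 * Z ^ 2 - X ^ 2 * Z ^ 4 - Y ^ 2 * Z ^ 4 + 3 * X ^ 2 * Y ^ 2 * Z ^ 2)"
  unfolding robinson_sextic_def Let_def poly_eval_add poly_eval_single monom_eval_mon3
    X_def[symmetric] Y_def[symmetric] Z_def[symmetric] power_add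
  by (simp add: algebra_simps)

text \<open>Multiplication by \<open>X\<^sup>2 + Y\<^sup>2\<close> turns the form into an explicit
  sum of three squares. Where this factor vanishes, only \<open>Z ^ 6\<close> remains.\<close>

lemma robinson_sextic_nonneg:
  fixes X Y Z :: real
  shows "X ^ 6 + Y ^ 6 + Z ^ 6 - X ^ 4 * Y ^ 2 - X ^ 4 * Z ^ 2 - X ^ 2 * Y ^ 4 - Y ^ 4 * Z ^ 2
    - X ^ 2 * Z ^ 4 - Y ^ 2 * Z ^ 4 + 3 * X ^ 2 * Y ^ 2 * Z ^ 2 \<ge> 0" (is "?R \<ge> 0")
proof (cases "X\<^sup>2 + Y\<^sup>2 = 0")
  case True
  then show ?thesis by (simp add: sum_power2_eq_zero_iff)
next
  case False
  then have "X\<^sup>2 + Y\<^sup>2 > 0" by (simp add: sum_power2_gt_zero_iff)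
  moreover have "(X\<^sup>2 + Y\<^sup>2) * ?R = (X * Z * (X\<^sup>2 - Z\<^sup>2))\<^sup>2 + (Y * Z * (Y\<^sup>2 - Z\<^sup>2))\<^sup>2
      + ((X\<^sup>2 - Y\<^sup>2) * (X\<^sup>2 + Y\<^sup>2 - Z\<^sup>2))\<^sup>2" by algebra
  then have "(X\<^sup>2 + Y\<^sup>2) * ?R \<ge> 0" by simp
  ultimately show ?thesis by (simp add: zero_le_mult_iff)
qed

lemma robinson_sextic_psd:
  "robinson_sextic x y z k \<in> psd_forms (k + 3)"
proof -
  have "robinson_sextic x y z k \<in> forms (2 * (k + 3))"
    unfolding robinson_sextic_def Let_def by (intro forms_add forms_mon3) auto
  moreover have "poly_eval (robinson_sextic x y z k) v \<ge> 0" for v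
    unfolding poly_eval_robinson_sextic by (intro mult_nonneg_nonneg robinson_sextic_nonneg) simp
  ultimately show ?thesis by (simp add: psd_forms_def)
qed

lemma robinson_sextic_keys:
  assumes "x \<noteq> y" "x \<noteq> z" "y \<noteq> z"
  shows "\<forall>\<alpha>\<in>Poly_Mapping.keys (robinson_sextic x y z k). \<alpha> $ x + \<alpha> $ y \<le> 6"
  unfolding robinson_sextic_def Let_def using assms
  by (intro keys_all_add keys_all_single) (simp_all add: mon3_nth)

text \<open>The relation is the product of the second differences in \<open>x\<close> and in
  \<open>y\<close> over the grid. Each annihilates exponents 0 and 1 of its variable, and total
  degree at most 3 in \<open>x\<close> and \<open>y\<close> makes one of the two exponents less than
  2.\<close>

lemma cubic_grid_relation:
  fixes g :: "'n::finite rpoly"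
  assumes xyz: "x \<noteq> y" "x \<noteq> z" "y \<noteq> z"
    and deg: "\<And>\<alpha>. \<alpha> \<in> Poly_Mapping.keys g \<Longrightarrow> \<alpha> $ x + \<alpha> $ y \<le> 3"
  defines "p \<equiv> \<lambda>a b. (\<chi> i. if i = x then a else if i = y then b else of_bool (i = z)) :: real ^ 'n"
  shows "4 * poly_eval g (p 0 0) = 2 * (poly_eval g (p 1 0) + poly_eval g (p (-1) 0)
     + poly_eval g (p 0 1) + poly_eval g (p 0 (-1)))
     - (poly_eval g (p 1 1) + poly_eval g (p 1 (-1)) + poly_eval g (p (-1) 1) + poly_eval g (p (-1) (-1)))"
proof -
  \<comment> \<open>The factor \<open>r\<close> comes from the remaining coordinates, which are the
    same at all nine grid points.\<close>
  have rest: "\<exists>r. \<forall>a b. monom_eval (p a b) \<alpha> = a ^ (\<alpha> $ x) * b ^ (\<alpha> $ y) * r" for \<alpha>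
  proof (intro exI allI)
    fix a b
    have "monom_eval (p a b) \<alpha> = p a b $ x ^ (\<alpha> $ x) * (p a b $ y ^ (\<alpha> $ y) *
       (\<Prod>i\<in>UNIV - {x} - {y}. p a b $ i ^ (\<alpha> $ i)))"
      unfolding monom_eval_def using xyz
      by (subst prod.remove[of UNIV x], simp, simp, subst prod.remove[of "UNIV - {x}" y]) auto
    also have "(\<Prod>i\<in>UNIV - {x} - {y}. p a b $ i ^ (\<alpha> $ i)) =
        (\<Prod>i\<in>UNIV - {x} - {y}. of_bool (i = z) ^ (\<alpha> $ i))"
      by (intro prod.cong) (auto simp: p_def)
    finally show "monom_eval (p a b) \<alpha> = a ^ (\<alpha> $ x) * b ^ (\<alpha> $ y) *
        (\<Prod>i\<in>UNIV - {x} - {y}. of_bool (i = z) ^ (\<alpha> $ i))"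
      using xyz by (simp add: p_def)
  qed
  let ?m = "\<lambda>\<alpha> a b. monom_eval (p a b) \<alpha>"
  have "4 * ?m \<alpha> 0 0 - 2 * (?m \<alpha> 1 0 + ?m \<alpha> (-1) 0 + ?m \<alpha> 0 1 + ?m \<alpha> 0 (-1))
     + (?m \<alpha> 1 1 + ?m \<alpha> 1 (-1) + ?m \<alpha> (-1) 1 + ?m \<alpha> (-1) (-1)) = 0"
    if \<alpha>: "\<alpha> \<in> Poly_Mapping.keys g" for \<alpha>
  proof -
    obtain r where r: "\<And>a b. ?m \<alpha> a b = a ^ (\<alpha> $ x) * b ^ (\<alpha> $ y) * r" using rest by blast
    \<comment> \<open>For \<open>j = 0\<close> the convention \<open>0 ^ 0 = 1\<close> gives 1 + 1 -
      2.\<close>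
    have second_difference: "(1 + (-1) ^ j - 2 * 0 ^ j :: real) = 0" if "j < 2" for j :: nat
      using that by (cases j) auto
    have "4 * ?m \<alpha> 0 0 - 2 * (?m \<alpha> 1 0 + ?m \<alpha> (-1) 0 + ?m \<alpha> 0 1 + ?m \<alpha> 0 (-1))
       + (?m \<alpha> 1 1 + ?m \<alpha> 1 (-1) + ?m \<alpha> (-1) 1 + ?m \<alpha> (-1) (-1))
       = (1 + (-1) ^ (\<alpha> $ x) - 2 * 0 ^ (\<alpha> $ x)) * (1 + (-1) ^ (\<alpha> $ y) - 2 * 0 ^ (\<alpha> $ y)) * r"
      unfolding r by (simp add: algebra_simps)
    moreover have "\<alpha> $ x < 2 \<or> \<alpha> $ y < 2" using deg[OF \<alpha>] by linarith
    ultimately show ?thesis using second_difference by auto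
  qed
  then have "(\<Sum>\<alpha>\<in>Poly_Mapping.keys g. Poly_Mapping.lookup g \<alpha> *
     (4 * ?m \<alpha> 0 0 - 2 * (?m \<alpha> 1 0 + ?m \<alpha> (-1) 0 + ?m \<alpha> 0 1 + ?m \<alpha> 0 (-1))
     + (?m \<alpha> 1 1 + ?m \<alpha> 1 (-1) + ?m \<alpha> (-1) 1 + ?m \<alpha> (-1) (-1)))) = 0"
    by simp
  then show ?thesis
    unfolding poly_eval_eq_coeff_sum coeff_sum_def
    by (simp add: algebra_simps sum.distrib sum_subtractf sum_distrib_left)
qed

lemma nonneg_circuit_eval_zero:
  assumes "c \<in> nonneg_circuits d" "\<And>v. poly_eval c v \<le> poly_eval f v" "poly_eval f v = 0"
  shows "poly_eval c v = 0"
proof (rule antisym)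
  show "poly_eval c v \<le> 0" using assms(2)[of v] assms(3) by simp
  show "0 \<le> poly_eval c v" using assms(1) by (auto simp: nonneg_circuits_def psd_forms_def)
qed

lemma robinson_sextic_not_sos_plus_sonc:
  fixes x y z :: "'n::finite"
  assumes xyz: "x \<noteq> y" "x \<noteq> z" "y \<noteq> z"
  shows "robinson_sextic x y z k \<notin> sos_plus_sonc_forms (k + 3)"
proof
  let ?f = "robinson_sextic x y z k" and ?e = "(\<chi> i. of_bool (i = z)) :: real ^ 'n "
  assume "?f \<in> sos_plus_sonc_forms (k + 3)"
  then have "poly_eval ?f ?e = 0"
  proof (rule sos_plus_sonc_eval_eq_zero)
    fix g :: "'n rpoly"
    assume dom: "\<And>v. (poly_eval g v)\<^sup>2 \<le> poly_eval ?f v"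
    have zero: "poly_eval g v = 0" if "poly_eval ?f v = 0" for v
      using dom[of v] that by simp
    have deg: "\<alpha> $ x + \<alpha> $ y \<le> 3" if "\<alpha> \<in> Poly_Mapping.keys g" for \<alpha>
    proof -
      have "\<forall>\<alpha>\<in>Poly_Mapping.keys ?f. 1 * real (\<alpha> $ x) + 1 * real (\<alpha> $ y) + 0 * real (\<alpha> $ z) \<le> 2 * 3"
        using robinson_sextic_keys[OF xyz, of k] by (auto simp flip: of_nat_add)
      from keys_linear_le[OF dom this that] show ?thesis by simp
    qed
    \<comment> \<open>The other eight grid points are zeros of \<open>?f\<close>, hence of
      \<open>g\<close>, so the relation leaves only the value at the centre.\<close>
    from cubic_grid_relation[of x y z g, OF xyz deg]
    have "poly_eval g (\<chi> i. if i = x then 0 else if i = y then 0 else of_bool (i = z)) = 0"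
      using xyz by (simp add: zero poly_eval_robinson_sextic)
    moreover have "(\<chi> i. if i = x then 0 else if i = y then 0 else of_bool (i = z)) = ?e"
      using xyz by (simp add: vec_eq_iff)
    ultimately show "poly_eval g ?e = 0" by simp
  next
    fix c :: "'n rpoly"
    assume c: "c \<in> nonneg_circuits (k + 3)" "\<And>v. poly_eval c v \<le> poly_eval ?f v"
    show "poly_eval c ?e = 0"
      by (rule circuit_eval_axis_eq_zero[OF c(1), of "{x, z}" "{y, z}"])
         (use xyz in \<open>auto intro!: nonneg_circuit_eval_zero[OF c] simp: poly_eval_robinson_sextic\<close>)
  qed
  \<comment> \<open>The sextic takes the value 1 at \<open>?e\<close>.\<close>
  then show False using xyz by (simp add: poly_eval_robinson_sextic)
qed

section \<open>Robinson's quartic and the cube\<close>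

text \<open>Robinson's quartic after the substitution of \<open>w - x\<close>, \<open>w - y\<close>, \<open>w - z\<close> for \<open>x\<close>, \<open>y\<close>, \<open>z\<close>, which moves
  the exceptional point of the cube to the \<open>w\<close>-axis.\<close>

definition robinson_quartic :: "'n \<Rightarrow> 'n \<Rightarrow> 'n \<Rightarrow> 'n \<Rightarrow> 'n::finite rpoly" where
  "robinson_quartic x y z w = (let W = var w; q = (\<lambda>i. var i * (var i - W)) in
     q x * q x + q y * q y + q z * q z
     + 2 * (((W - var x) * (W - var y)) * ((W - var z) * (W - var x - var y - var z))))"

lemma poly_eval_robinson_quartic:
  fixes v :: "real ^ 'n::finite" and x y z w :: 'n
  defines "X \<equiv> v $ x" and "Y \<equiv> v $ y" and "Z \<equiv> v $ z" and "W \<equiv> v $ w"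
  shows "poly_eval (robinson_quartic x y z w) v = (X * (X - W))\<^sup>2 + (Y * (Y - W))\<^sup>2 + (Z * (Z - W))\<^sup>2
    + 2 * ((W - X) * (W - Y) * (W - Z) * (W - X - Y - Z))"
  by (simp add: robinson_quartic_def Let_def assms power2_eq_square)

text \<open>There are three representations as two squares plus twice a product of four linear
  forms, one for each choice of a variable. The three products multiply to a perfect square, so they
  cannot all be negative.\<close>

lemma robinson_quartic_nonneg:
  fixes X Y Z W :: real
  shows "(X * (X - W))\<^sup>2 + (Y * (Y - W))\<^sup>2 + (Z * (Z - W))\<^sup>2
    + 2 * ((W - X) * (W - Y) * (W - Z) * (W - X - Y - Z)) \<ge> 0" (is "?Q \<ge> 0")
proof -
  define a b c p q r where "a = W - X" and "b = W - Y" and "c = W - Z"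
    and "p = W - Y - Z" and "q = W - X - Z" and "r = W - X - Y"
  note defs = a_def b_def c_def p_def q_def r_def
  have "(b * c * q * r) * (a * c * p * r) * (a * b * p * q) = (a * b * c * p * q * r)\<^sup>2"
    by (simp add: power2_eq_square mult_ac)
  then have "(b * c * q * r) * (a * c * p * r) * (a * b * p * q) \<ge> 0" by simp
  then consider "b * c * q * r \<ge> 0" | "a * c * p * r \<ge> 0" | "a * b * p * q \<ge> 0"
    by (meson linorder_not_le mult_neg_neg mult_pos_neg)
  then show ?thesis
  proof cases
    case 1
    have eq: "?Q = (X * (X - W))\<^sup>2 + (Y * (Y - W) - Z * (Z - W))\<^sup>2 + 2 * (b * c * q * r)"
      unfolding defs by algebra
    show ?thesis unfolding eq using 1 by simp
  next
    case 2
    have eq: "?Q = (Y * (Y - W))\<^sup>2 + (X * (X - W) - Z * (Z - W))\<^sup>2 + 2 * (a * c * p * r)"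
      unfolding defs by algebra
    show ?thesis unfolding eq using 2 by simp
  next
    case 3
    have eq: "?Q = (Z * (Z - W))\<^sup>2 + (X * (X - W) - Y * (Y - W))\<^sup>2 + 2 * (a * b * p * q)"
      unfolding defs by algebra
    show ?thesis unfolding eq using 3 by simp
  qed
qed

lemma robinson_quartic_psd: "robinson_quartic x y z w \<in> psd_forms 2"
proof -
  have mult: "p * q \<in> forms 2" if "p \<in> forms 1" "q \<in> forms 1" for p q :: "'a rpoly"
    using forms_mult[OF that] by (simp add: numeral_2_eq_2)
  have mult': "p * q \<in> forms 4" if "p \<in> forms 2" "q \<in> forms 2" for p q :: "'a rpoly"
    using forms_mult[OF that] by simp
  have "robinson_quartic x y z w \<in> forms 4"
    unfolding robinson_quartic_def Let_def
    by (intro forms_add forms_numeral_mult mult' mult forms_diff forms_var)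
  then show ?thesis
    using robinson_quartic_nonneg by (auto simp: psd_forms_def poly_eval_robinson_quartic)
qed

text \<open>Inclusion-exclusion over the subsets of the three variables: a quadratic monomial misses
  one of \<open>x\<close>, \<open>y\<close>, \<open>z\<close>, and the vertices of the cube then
  cancel in pairs along that direction.\<close>

lemma quadric_cube_relation:
  fixes g :: "'n::finite rpoly"
  assumes g: "g \<in> forms 2" and xyz: "x \<noteq> y" "x \<noteq> z" "y \<noteq> z"
  defines "E \<equiv> \<lambda>T. poly_eval g (\<chi> i. of_bool (i \<in> T))"
  shows "E {w} = E {x, w} + E {y, w} + E {z, w} - E {x, y, w} - E {x, z, w} - E {y, z, w} + E {x, y, z, w}"
proof -
  define P where "P \<alpha> T = (of_bool ({i. \<alpha> $ i \<noteq> 0} \<subseteq> T) :: real)" for \<alpha> :: "nat ^ 'n" and T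
  have E: "E T = (\<Sum>\<alpha>\<in>Poly_Mapping.keys g. Poly_Mapping.lookup g \<alpha> * P \<alpha> T)" for T
    unfolding E_def poly_eval_eq_coeff_sum coeff_sum_def monom_eval_indicator P_def
    by (simp add: subset_eq)
  have "P \<alpha> {w} = P \<alpha> {x, w} + P \<alpha> {y, w} + P \<alpha> {z, w} - P \<alpha> {x, y, w} - P \<alpha> {x, z, w}
     - P \<alpha> {y, z, w} + P \<alpha> {x, y, z, w}" if "\<alpha> \<in> Poly_Mapping.keys g" for \<alpha>
  proof -
    have "(\<Sum>i\<in>{x, y, z}. \<alpha> $ i) \<le> (\<Sum>i\<in>UNIV. \<alpha> $ i)" by (rule sum_mono2) auto
    also have "\<dots> = 2" using g that by (auto simp: forms_def)
    finally have "\<alpha> $ x = 0 \<or> \<alpha> $ y = 0 \<or> \<alpha> $ z = 0" using xyz by auto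
    moreover have "P \<alpha> (insert a T) = P \<alpha> T"
      "P \<alpha> (insert b (insert a T)) = P \<alpha> (insert b T)"
      "P \<alpha> (insert b (insert c (insert a T))) = P \<alpha> (insert b (insert c T))"
      if "\<alpha> $ a = 0" for a b c T
      using that by (auto simp: P_def)
    ultimately show ?thesis by auto
  qed
  then show ?thesis
    unfolding E
    by (simp add: sum.distrib[symmetric] sum_subtractf[symmetric] distrib_left[symmetric]
        right_diff_distrib[symmetric])
qed

lemma robinson_quartic_not_sos_plus_sonc:
  fixes x y z w :: "'n::finite"
  assumes ne: "x \<noteq> y" "x \<noteq> z" "y \<noteq> z" "x \<noteq> w" "y \<noteq> w" "z \<noteq> w"
  shows "robinson_quartic x y z w \<notin> sos_plus_sonc_forms 2"
proof
  let ?f = "robinson_quartic x y z w" and ?e = "(\<chi> i. of_bool (i = w)) :: real ^ 'n"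
  assume "?f \<in> sos_plus_sonc_forms 2"
  then have "poly_eval ?f ?e = 0"
  proof (rule sos_plus_sonc_eval_eq_zero)
    fix g :: "'n rpoly"
    assume g: "g \<in> forms 2" and dom: "\<And>v. (poly_eval g v)\<^sup>2 \<le> poly_eval ?f v"
    have zero: "poly_eval g v = 0" if "poly_eval ?f v = 0" for v
      using dom[of v] that by simp
    show "poly_eval g ?e = 0"
      \<comment> \<open>The seven cube vertices on the right are zeros of \<open>?f\<close>; at the
        remaining one, \<open>?e\<close>, its value is 2.\<close>
      using quadric_cube_relation[OF g ne(1-3), of w] ne
      by (simp add: zero poly_eval_robinson_quartic)
  next
    fix c :: "'n rpoly"
    assume c: "c \<in> nonneg_circuits 2" "\<And>v. poly_eval c v \<le> poly_eval ?f v"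
    show "poly_eval c ?e = 0"
      by (rule circuit_eval_axis_eq_zero[OF c(1), of "{x, w}" "{y, w}"])
         (use ne in \<open>auto intro!: nonneg_circuit_eval_zero[OF c] simp: poly_eval_robinson_quartic\<close>)
  qed
  then show False using ne by (simp add: poly_eval_robinson_quartic)
qed

section \<open>Sums of a square and a circuit\<close>

lemma form_key_sum:
  assumes "g \<in> forms k" "\<alpha> \<in> Poly_Mapping.keys g" "\<And>i. i \<notin> S \<Longrightarrow> \<alpha> $ i = 0"
  shows "(\<Sum>i\<in>S. \<alpha> $ i) = k"
proof -
  have "(\<Sum>i\<in>UNIV. \<alpha> $ i) = (\<Sum>i\<in>S. \<alpha> $ i)"
    by (rule sum.mono_neutral_right) (use assms(3) in auto)
  then show ?thesis using assms(1,2) by (auto simp: forms_def)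
qed

lemma axis_add: "axis i (a + b) = axis i a + axis i (b :: 'a::monoid_add)"
  by (simp add: vec_eq_iff axis_def)

lemma mon3_add: "mon3 x y z a b c + mon3 x y z a' b' c' = mon3 x y z (a + a') (b + b') (c + c')"
  by (simp add: mon3_def axis_add add_ac)

lemma mon3_eq_iff:
  assumes "x \<noteq> y" "x \<noteq> z" "y \<noteq> z"
  shows "mon3 x y z a b c = mon3 x y z a' b' c' \<longleftrightarrow> a = a' \<and> b = b' \<and> c = c'"
proof
  assume "mon3 x y z a b c = mon3 x y z a' b' c'"
  then have "mon3 x y z a b c $ i = mon3 x y z a' b' c' $ i" for i by simp
  from this[of x] this[of y] this[of z] assms
  show "a = a' \<and> b = b' \<and> c = c'" by (simp add: mon3_nth)
qed simp

lemma all_even_mon3: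
  assumes "x \<noteq> y" "x \<noteq> z" "y \<noteq> z"
  shows "(\<forall>i. even (mon3 x y z a b c $ i)) \<longleftrightarrow> even a \<and> even b \<and> even c"
proof
  assume H: "\<forall>i. even (mon3 x y z a b c $ i)"
  show "even a \<and> even b \<and> even c"
    using H[THEN spec, of x] H[THEN spec, of y] H[THEN spec, of z] assms by (simp add: mon3_nth)
qed (simp add: mon3_nth[OF assms])

section \<open>Degree at least six: the Motzkin form\<close>

definition motzkin_circuit :: "'n \<Rightarrow> 'n \<Rightarrow> 'n \<Rightarrow> nat \<Rightarrow> 'n::finite rpoly" where
  "motzkin_circuit x y z k = (let t = (\<lambda>a b c. Poly_Mapping.single (mon3 x y z a b (2 * k + c))) in
     t 0 0 6 1 + t 4 2 0 1 + t 2 4 0 1 + t 2 2 2 (-3))"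

text \<open>With \<open>r\<close> the absolute value of \<open>X * Y\<close>, the bound
  \<open>2 * r \<le> X\<^sup>2 + Y\<^sup>2\<close> reduces the claim to a cubic in
  \<open>Z\<^sup>2\<close> with the double root \<open>r\<close>.\<close>

lemma motzkin_nonneg:
  fixes X Y Z :: real
  shows "Z ^ 6 + X ^ 4 * Y ^ 2 + X ^ 2 * Y ^ 4 - 3 * X ^ 2 * Y ^ 2 * Z ^ 2 \<ge> 0"
proof -
  define r where "r = \<bar>X * Y\<bar>"
  have r: "r\<^sup>2 = X\<^sup>2 * Y\<^sup>2" "r \<ge> 0" by (simp_all add: r_def power_mult_distrib)
  have "0 \<le> (\<bar>X\<bar> - \<bar>Y\<bar>)\<^sup>2" by simp
  then have "2 * r \<le> X\<^sup>2 + Y\<^sup>2" by (simp add: r_def power2_diff abs_mult)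
  then have "r\<^sup>2 * (2 * r) \<le> r\<^sup>2 * (X\<^sup>2 + Y\<^sup>2)" by (intro mult_left_mono) auto
  moreover have "(Z\<^sup>2 - r)\<^sup>2 * (Z\<^sup>2 + 2 * r) \<ge> 0" using r(2) by simp
  moreover have "(Z\<^sup>2 - r)\<^sup>2 * (Z\<^sup>2 + 2 * r) = Z ^ 6 + r\<^sup>2 * (2 * r) - 3 * r\<^sup>2 * Z\<^sup>2" by algebra
  moreover have "r\<^sup>2 * (X\<^sup>2 + Y\<^sup>2) = X ^ 4 * Y ^ 2 + X ^ 2 * Y ^ 4" unfolding r by algebra
  ultimately show ?thesis unfolding r(1) by (simp add: mult.assoc)
qed

lemma motzkin_circuit_nonneg_circuit:
  fixes x y z :: "'n::finite"
  assumes xyz: "x \<noteq> y" "x \<noteq> z" "y \<noteq> z"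
  shows "motzkin_circuit x y z k \<in> nonneg_circuits (k + 3)"
proof -
  let ?h = "motzkin_circuit x y z k"
  let ?m = "\<lambda>a b c. mon3 x y z a b (2 * k + c)"
  have "?h \<in> forms (2 * (k + 3))"
    unfolding motzkin_circuit_def Let_def by (intro forms_add forms_mon3) auto
  moreover have "poly_eval ?h v \<ge> 0" for v
  proof -
    have "poly_eval ?h v = v $ z ^ (2 * k) * (v $ z ^ 6 + v $ x ^ 4 * v $ y ^ 2 + v $ x ^ 2 * v $ y ^ 4
        - 3 * v $ x ^ 2 * v $ y ^ 2 * v $ z ^ 2)"
      by (simp add: motzkin_circuit_def Let_def poly_eval_single monom_eval_mon3 power_add algebra_simps
          power2_eq_square)
    then show ?thesis using motzkin_nonneg[of "v $ z" "v $ x" "v $ y"] by simp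
  qed
  moreover have "is_circuit ?h"
  \<comment> \<open>The inner exponent is the centroid of the triangle, whence the weights
    1/3.\<close>
  proof (rule is_circuitI[where A = "{?m 0 0 6, ?m 4 2 0, ?m 2 4 0}" and \<beta> = "?m 2 2 2" and u = "\<lambda>_. 1 / 3"])
    note lookup = motzkin_circuit_def Let_def lookup_add lookup_single when_def mon3_eq_iff[OF xyz]
    show "Poly_Mapping.keys ?h = insert (?m 2 2 2) {?m 0 0 6, ?m 4 2 0, ?m 2 4 0}"
      by (auto simp: in_keys_iff lookup split: if_splits)
    show "Poly_Mapping.lookup ?h (?m 2 2 2) < 0" by (simp add: lookup)
    show "Poly_Mapping.lookup ?h \<alpha> > 0" if "\<alpha> \<in> {?m 0 0 6, ?m 4 2 0, ?m 2 4 0}" for \<alpha>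
      using that by (auto simp: lookup)
    show "even (\<alpha> $ i)" if "\<alpha> \<in> {?m 0 0 6, ?m 4 2 0, ?m 2 4 0}" for \<alpha> i
      using that by (auto simp: mon3_nth[OF xyz])
    show "\<forall>\<alpha>\<in>{?m 0 0 6, ?m 4 2 0, ?m 2 4 0}. u \<alpha> = 0"
      if "sum u {?m 0 0 6, ?m 4 2 0, ?m 2 4 0} = 0"
        and "\<And>i. (\<Sum>\<alpha>\<in>{?m 0 0 6, ?m 4 2 0, ?m 2 4 0}. u \<alpha> * real (\<alpha> $ i)) = 0" for u
      using that(1) that(2)[of x] that(2)[of y] xyz
      by (simp add: mon3_eq_iff[OF xyz] mon3_nth[OF xyz])
    show "(\<Sum>\<alpha>\<in>{?m 0 0 6, ?m 4 2 0, ?m 2 4 0}. 1 / 3 * real (\<alpha> $ i)) = real (?m 2 2 2 $ i)" for i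
      by (simp add: mon3_eq_iff[OF xyz] mon3_nth[OF xyz] field_simps)
  qed (auto simp: mon3_eq_iff[OF xyz])
  ultimately show ?thesis by (simp add: nonneg_circuits_def psd_forms_def)
qed

lemma sextic_sum_separates:
  fixes x y z :: "'n::finite"
  assumes xyz: "x \<noteq> y" "x \<noteq> z" "y \<noteq> z"
  shows "\<exists>f \<in> sos_plus_sonc_forms (k + 3) :: 'n rpoly set. f \<notin> sos_forms (k + 3) \<and> f \<notin> sonc_forms (k + 3)"
proof -
  let ?m = "mon3 x y z"
  \<comment> \<open>This is \<open>z^k * (x^2 y + x y^2 + x y z)\<close>: its exponents are halves
    of two vertices and of the inner exponent of the Motzkin circuit, so \<open>q * q\<close> does
    not enlarge the Newton polytope.\<close>
  define q where "q = Poly_Mapping.single (?m 2 1 k) 1 + Poly_Mapping.single (?m 1 2 k) 1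
    + Poly_Mapping.single (?m 1 1 (k + 1)) (1::real)"
  define f where "f = q * q + motzkin_circuit x y z k"
  note expand = f_def q_def motzkin_circuit_def Let_def distrib_left distrib_right mult_single mon3_add
  have "q \<in> forms (k + 3)"
    unfolding q_def by (intro forms_add forms_mon3) auto
  then have "f \<in> sos_plus_sonc_forms (k + 3)"
    using sos_forms_square sonc_forms_circuit[OF motzkin_circuit_nonneg_circuit[OF xyz]]
    unfolding f_def sos_plus_sonc_forms_def by blast
  moreover have "f \<notin> sonc_forms (k + 3)"
  proof
    assume f: "f \<in> sonc_forms (k + 3)"
    define \<sigma> :: "nat ^ 'n \<Rightarrow> real" where "\<sigma> \<alpha> = (if \<forall>i. even (\<alpha> $ i) then 1 else - 1)" for \<alpha>
    have "coeff_sum \<sigma> f \<ge> 0"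
      by (rule sonc_coeff_sum_nonneg[OF f]) (auto simp: \<sigma>_def)
    moreover have "\<sigma> (?m a b c) = (if even a \<and> even b \<and> even c then 1 else - 1)" for a b c
      by (simp add: \<sigma>_def all_even_mon3[OF xyz])
    \<comment> \<open>The even coefficients add up to 1 + 2 + 2 - 2 = 3, while the three cross terms
      of \<open>q * q\<close> contribute 6 with negative sign.\<close>
    ultimately show False
      unfolding expand coeff_sum_add coeff_sum_single by simp
  qed
  moreover have "f \<notin> sos_forms (k + 3)"
  proof
    let ?\<delta> = "?m 2 2 (2 * k + 2)"
    assume "f \<in> sos_forms (k + 3)"
    then have "Poly_Mapping.lookup f ?\<delta> \<ge> 0"
    proof (rule sos_lookup_nonneg)
      fix g :: "'n rpoly" and \<alpha> \<beta>
      assume g: "g \<in> forms (k + 3)" and dom: "\<And>v. (poly_eval g v)\<^sup>2 \<le> poly_eval f v"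
        and keys: "\<alpha> \<in> Poly_Mapping.keys g" "\<beta> \<in> Poly_Mapping.keys g" and sum: "\<alpha> + \<beta> = ?\<delta>"
      \<comment> \<open>In the \<open>x\<close> and \<open>y\<close> exponents the Newton polytope
        is the triangle (0,0), (4,2), (2,4); these are the facet inequalities of its half.\<close>
      have weights: "\<gamma> $ x + \<gamma> $ y \<le> 3 \<and> \<gamma> $ x \<le> 2 * \<gamma> $ y \<and> \<gamma> $ y \<le> 2 * \<gamma> $ x"
        if \<gamma>: "\<gamma> \<in> Poly_Mapping.keys g" for \<gamma>
      proof -
        have "1 * real (\<gamma> $ x) + 1 * real (\<gamma> $ y) + 0 * real (\<gamma> $ z) \<le> 3"
          by (rule keys_linear_le[OF dom _ \<gamma>], unfold expand, intro keys_all_add keys_all_single)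
             (use xyz in \<open>simp_all add: mon3_nth\<close>)
        moreover have "1 * real (\<gamma> $ x) + (- 2) * real (\<gamma> $ y) + 0 * real (\<gamma> $ z) \<le> 0"
          by (rule keys_linear_le[OF dom _ \<gamma>], unfold expand, intro keys_all_add keys_all_single)
             (use xyz in \<open>simp_all add: mon3_nth\<close>)
        moreover have "(- 2) * real (\<gamma> $ x) + 1 * real (\<gamma> $ y) + 0 * real (\<gamma> $ z) \<le> 0"
          by (rule keys_linear_le[OF dom _ \<gamma>], unfold expand, intro keys_all_add keys_all_single)
             (use xyz in \<open>simp_all add: mon3_nth\<close>)
        ultimately show ?thesis by linarith
      qed
      have nth: "\<alpha> $ i + \<beta> $ i = ?\<delta> $ i" for i
        using sum by (metis vector_add_component)
      have other: "\<alpha> $ i = 0 \<and> \<beta> $ i = 0" if "i \<notin> {x, y, z}" for i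
        using that nth[of i] by (simp add: mon3_nth[OF xyz])
      have "\<alpha> $ x + \<alpha> $ y + \<alpha> $ z = k + 3" "\<beta> $ x + \<beta> $ y + \<beta> $ z = k + 3"
        using form_key_sum[OF g keys(1), of "{x, y, z}"] form_key_sum[OF g keys(2), of "{x, y, z}"]
          other xyz by auto
      \<comment> \<open>The half triangle has the lattice points (0,0), (1,1), (2,1), (1,2), and
        only (1,1) + (1,1) gives (2,2).\<close>
      moreover have "\<alpha> $ x = 1 \<and> \<alpha> $ y = 1 \<and> \<beta> $ x = 1 \<and> \<beta> $ y = 1"
        using weights[OF keys(1)] weights[OF keys(2)] nth[of x] nth[of y] xyz by (simp add: mon3_nth)
      ultimately have "\<alpha> $ i = \<beta> $ i" for i
        using other[of i] by (cases "i \<in> {x, y, z}") auto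
      then show "\<alpha> = \<beta>" by (simp add: vec_eq_iff)
    qed
    moreover have "Poly_Mapping.lookup f ?\<delta> = - 2"
      unfolding expand lookup_add lookup_single when_def mon3_eq_iff[OF xyz] by simp
    ultimately show False by simp
  qed
  ultimately show ?thesis by blast
qed

section \<open>Quartics in at least four variables: the Choi-Lam form\<close>

definition mon4 :: "'n \<Rightarrow> 'n \<Rightarrow> 'n \<Rightarrow> 'n \<Rightarrow> nat \<Rightarrow> nat \<Rightarrow> nat \<Rightarrow> nat \<Rightarrow> nat ^ 'n::finite" where
  "mon4 x y z w a b c e = mon3 x y z a b c + axis w e"

lemma monom_eval_mon4: "monom_eval v (mon4 x y z w a b c e) = v $ x ^ a * v $ y ^ b * v $ z ^ c * v $ w ^ e"
  by (simp add: mon4_def monom_eval_add monom_eval_mon3 monom_eval_axis)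

lemma forms_mon4: "a + b + c + e = k \<Longrightarrow> Poly_Mapping.single (mon4 x y z w a b c e) r \<in> forms k"
  by (intro forms_single) (simp add: mon4_def mon3_def sum.distrib sum_axis)

lemma mon4_add:
  "mon4 x y z w a b c e + mon4 x y z w a' b' c' e' = mon4 x y z w (a + a') (b + b') (c + c') (e + e')"
  by (simp add: mon4_def mon3_def axis_add add_ac)

context
  fixes x y z w :: "'n::finite"
  assumes ne: "x \<noteq> y" "x \<noteq> z" "y \<noteq> z" "x \<noteq> w" "y \<noteq> w" "z \<noteq> w"
begin

lemma mon4_nth: "mon4 x y z w a b c e $ i =
    (if i = x then a else if i = y then b else if i = z then c else if i = w then e else 0)"
  using ne by (auto simp: mon4_def mon3_nth axis_def)

lemma mon4_eq_iff:
  "mon4 x y z w a b c e = mon4 x y z w a' b' c' e' \<longleftrightarrow> a = a' \<and> b = b' \<and> c = c' \<and> e = e'"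
proof
  assume "mon4 x y z w a b c e = mon4 x y z w a' b' c' e'"
  then have "mon4 x y z w a b c e $ i = mon4 x y z w a' b' c' e' $ i" for i by simp
  from this[of x] this[of y] this[of z] this[of w] ne
  show "a = a' \<and> b = b' \<and> c = c' \<and> e = e'" by (simp add: mon4_nth)
qed simp

lemma all_even_mon4: "(\<forall>i. even (mon4 x y z w a b c e $ i)) \<longleftrightarrow> even a \<and> even b \<and> even c \<and> even e"
proof
  assume H: "\<forall>i. even (mon4 x y z w a b c e $ i)"
  show "even a \<and> even b \<and> even c \<and> even e"
    using H[THEN spec, of x] H[THEN spec, of y] H[THEN spec, of z] H[THEN spec, of w] ne
    by (simp add: mon4_nth)
qed (simp add: mon4_nth)

end

definition choi_lam_circuit :: "'n \<Rightarrow> 'n \<Rightarrow> 'n \<Rightarrow> 'n \<Rightarrow> 'n::finite rpoly" where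
  "choi_lam_circuit x y z w = (let t = (\<lambda>a b c e. Poly_Mapping.single (mon4 x y z w a b c e)) in
     t 0 0 0 4 1 + t 2 2 0 0 1 + t 0 2 2 0 1 + t 2 0 2 0 1 + t 1 1 1 1 (-4))"

text \<open>The inequality of arithmetic and geometric means for the four even terms, with the
  difference written explicitly as nonnegative terms after passing to absolute values.\<close>

lemma choi_lam_nonneg:
  fixes X Y Z W :: real
  shows "W ^ 4 + X ^ 2 * Y ^ 2 + Y ^ 2 * Z ^ 2 + X ^ 2 * Z ^ 2 - 4 * X * Y * Z * W \<ge> 0"
proof -
  have "W ^ 4 + X ^ 2 * Y ^ 2 + Y ^ 2 * Z ^ 2 + X ^ 2 * Z ^ 2 - 4 * \<bar>Y * Z\<bar> * \<bar>X * W\<bar>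
    = (W\<^sup>2 - \<bar>Y * Z\<bar>)\<^sup>2 + X\<^sup>2 * (\<bar>Y\<bar> - \<bar>Z\<bar>)\<^sup>2 + 2 * \<bar>Y * Z\<bar> * (\<bar>W\<bar> - \<bar>X\<bar>)\<^sup>2"
    by (simp add: power2_diff abs_mult power_mult_distrib algebra_simps flip: power_add power_mult)
  also have "\<dots> \<ge> 0" by (intro add_nonneg_nonneg mult_nonneg_nonneg) auto
  finally have "4 * (\<bar>Y * Z\<bar> * \<bar>X * W\<bar>) \<le> W ^ 4 + X ^ 2 * Y ^ 2 + Y ^ 2 * Z ^ 2 + X ^ 2 * Z ^ 2" by simp
  moreover have "X * Y * Z * W \<le> \<bar>Y * Z\<bar> * \<bar>X * W\<bar>"
    using abs_ge_self[of "X * Y * Z * W"] by (simp add: abs_mult mult_ac)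
  ultimately show ?thesis by (simp add: mult.assoc)
qed

lemma choi_lam_circuit_nonneg_circuit:
  fixes x y z w :: "'n::finite"
  assumes ne: "x \<noteq> y" "x \<noteq> z" "y \<noteq> z" "x \<noteq> w" "y \<noteq> w" "z \<noteq> w"
  shows "choi_lam_circuit x y z w \<in> nonneg_circuits 2"
proof -
  let ?h = "choi_lam_circuit x y z w"
  let ?m = "mon4 x y z w"
  let ?A = "{?m 0 0 0 4, ?m 2 2 0 0, ?m 0 2 2 0, ?m 2 0 2 0}"
  have "?h \<in> forms 4"
    unfolding choi_lam_circuit_def Let_def by (intro forms_add forms_mon4) auto
  moreover have "poly_eval ?h v \<ge> 0" for v
    using choi_lam_nonneg[of "v $ w" "v $ x" "v $ y" "v $ z"]
    by (simp add: choi_lam_circuit_def Let_def poly_eval_single monom_eval_mon4 mult.assoc)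
  moreover have "is_circuit ?h"
  \<comment> \<open>The inner exponent is the centroid of the four vertices of a
    tetrahedron.\<close>
  proof (rule is_circuitI[where A = ?A and \<beta> = "?m 1 1 1 1" and u = "\<lambda>_. 1 / 4"])
    note lookup = choi_lam_circuit_def Let_def lookup_add lookup_single when_def mon4_eq_iff[OF ne]
    show "Poly_Mapping.keys ?h = insert (?m 1 1 1 1) ?A"
      by (auto simp: in_keys_iff lookup split: if_splits)
    show "Poly_Mapping.lookup ?h (?m 1 1 1 1) < 0" by (simp add: lookup)
    show "Poly_Mapping.lookup ?h \<alpha> > 0" if "\<alpha> \<in> ?A" for \<alpha>
      using that by (auto simp: lookup)
    show "even (\<alpha> $ i)" if "\<alpha> \<in> ?A" for \<alpha> i
      using that by (auto simp: mon4_nth[OF ne])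
    show "\<forall>\<alpha>\<in>?A. u \<alpha> = 0"
      if "sum u ?A = 0" and "\<And>i. (\<Sum>\<alpha>\<in>?A. u \<alpha> * real (\<alpha> $ i)) = 0" for u
      using that(1) that(2)[of x] that(2)[of y] that(2)[of z] ne
      by (simp add: mon4_eq_iff[OF ne] mon4_nth[OF ne])
    show "(\<Sum>\<alpha>\<in>?A. 1 / 4 * real (\<alpha> $ i)) = real (?m 1 1 1 1 $ i)" for i
      by (simp add: mon4_eq_iff[OF ne] mon4_nth[OF ne])
  qed (auto simp: mon4_eq_iff[OF ne])
  ultimately show ?thesis by (simp add: nonneg_circuits_def psd_forms_def)
qed

lemma quartic_sum_separates:
  fixes x y z w :: "'n::finite"
  assumes ne: "x \<noteq> y" "x \<noteq> z" "y \<noteq> z" "x \<noteq> w" "y \<noteq> w" "z \<noteq> w"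
  shows "\<exists>f \<in> sos_plus_sonc_forms 2 :: 'n rpoly set. f \<notin> sos_forms 2 \<and> f \<notin> sonc_forms 2"
proof -
  let ?m = "mon4 x y z w"
  let ?\<delta> = "?m 1 1 1 1"
  \<comment> \<open>This is \<open>x y + y z + x z\<close>, whose exponents are halves of three
    vertices; no term of \<open>q * q\<close> meets \<open>?\<delta>\<close>.\<close>
  define q where "q = Poly_Mapping.single (?m 1 1 0 0) 1 + Poly_Mapping.single (?m 0 1 1 0) 1
    + Poly_Mapping.single (?m 1 0 1 0) (1::real)"
  define f where "f = q * q + choi_lam_circuit x y z w"
  note expand = f_def q_def choi_lam_circuit_def Let_def distrib_left distrib_right mult_single mon4_add
  have "q \<in> forms 2"
    unfolding q_def by (intro forms_add forms_mon4) auto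
  then have "f \<in> sos_plus_sonc_forms 2"
    using sos_forms_square sonc_forms_circuit[OF choi_lam_circuit_nonneg_circuit[OF ne]]
    unfolding f_def sos_plus_sonc_forms_def by blast
  moreover have "f \<notin> sonc_forms 2"
  proof
    assume f: "f \<in> sonc_forms 2"
    \<comment> \<open>The coefficient at \<open>?\<delta>\<close> is negative and the other non-even ones are positive.\<close>
    define \<sigma> :: "nat ^ 'n \<Rightarrow> real"
      where "\<sigma> \<alpha> = (if \<alpha> = ?\<delta> \<or> (\<forall>i. even (\<alpha> $ i)) then 1 else - 1)" for \<alpha>
    have "coeff_sum \<sigma> f \<ge> 0"
      by (rule sonc_coeff_sum_nonneg[OF f]) (auto simp: \<sigma>_def)
    moreover have "\<sigma> (?m a b c e) = (if ?m a b c e = ?\<delta> \<or> even a \<and> even b \<and> even c \<and> even e then 1 else - 1)"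
      for a b c e
      by (simp add: \<sigma>_def all_even_mon4[OF ne])
    \<comment> \<open>The signed sum is 1 + 6 - 4 - 6 = -3: the even coefficients, the one at
      \<open>?\<delta>\<close>, and the cross terms.\<close>
    ultimately show False
      unfolding expand coeff_sum_add coeff_sum_single by (simp add: mon4_eq_iff[OF ne])
  qed
  moreover have "f \<notin> sos_forms 2"
  proof
    assume "f \<in> sos_forms 2"
    then have "Poly_Mapping.lookup f ?\<delta> \<ge> 0"
    proof (rule sos_lookup_nonneg)
      fix g :: "'n rpoly" and \<alpha> \<beta>
      assume g: "g \<in> forms 2" and dom: "\<And>v. (poly_eval g v)\<^sup>2 \<le> poly_eval f v"
        and keys: "\<alpha> \<in> Poly_Mapping.keys g" "\<beta> \<in> Poly_Mapping.keys g" and sum: "\<alpha> + \<beta> = ?\<delta>"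
      \<comment> \<open>The triangle inequalities are the facets of the Newton polytope through the
        vertex of \<open>w^4\<close>.\<close>
      have weights: "\<gamma> $ x \<le> \<gamma> $ y + \<gamma> $ z \<and> \<gamma> $ y \<le> \<gamma> $ x + \<gamma> $ z \<and> \<gamma> $ z \<le> \<gamma> $ x + \<gamma> $ y"
        if \<gamma>: "\<gamma> \<in> Poly_Mapping.keys g" for \<gamma>
      proof -
        have "1 * real (\<gamma> $ x) + (-1) * real (\<gamma> $ y) + (-1) * real (\<gamma> $ z) \<le> 0"
          by (rule keys_linear_le[OF dom _ \<gamma>], unfold expand, intro keys_all_add keys_all_single)
             (use ne in \<open>simp_all add: mon4_nth\<close>)
        moreover have "(-1) * real (\<gamma> $ x) + 1 * real (\<gamma> $ y) + (-1) * real (\<gamma> $ z) \<le> 0"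
          by (rule keys_linear_le[OF dom _ \<gamma>], unfold expand, intro keys_all_add keys_all_single)
             (use ne in \<open>simp_all add: mon4_nth\<close>)
        moreover have "(-1) * real (\<gamma> $ x) + (-1) * real (\<gamma> $ y) + 1 * real (\<gamma> $ z) \<le> 0"
          by (rule keys_linear_le[OF dom _ \<gamma>], unfold expand, intro keys_all_add keys_all_single)
             (use ne in \<open>simp_all add: mon4_nth\<close>)
        ultimately show ?thesis by linarith
      qed
      have nth: "\<alpha> $ i + \<beta> $ i = ?\<delta> $ i" for i
        using sum by (metis vector_add_component)
      have "\<alpha> $ i = 0 \<and> \<beta> $ i = 0" if "i \<notin> {x, y, z, w}" for i
        using that nth[of i] by (auto simp: mon4_nth[OF ne])
      then have "\<alpha> $ x + \<alpha> $ y + \<alpha> $ z + \<alpha> $ w = 2" "\<beta> $ x + \<beta> $ y + \<beta> $ z + \<beta> $ w = 2"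
        using form_key_sum[OF g keys(1), of "{x, y, z, w}"]
          form_key_sum[OF g keys(2), of "{x, y, z, w}"] ne by auto
      moreover have "\<gamma> $ x + \<gamma> $ y + \<gamma> $ z \<noteq> 1" if "\<gamma> \<in> Poly_Mapping.keys g" for \<gamma>
        using weights[OF that] by presburger
      from this[OF keys(1)] this[OF keys(2)]
      have "\<alpha> $ x + \<alpha> $ y + \<alpha> $ z \<noteq> 1" "\<beta> $ x + \<beta> $ y + \<beta> $ z \<noteq> 1" .
      moreover have "\<alpha> $ w + \<beta> $ w = 1"
        using nth[of w] ne by (simp add: mon4_nth)
      \<comment> \<open>One of the two exponents contains \<open>w\<close> exactly once, so its
        other entries sum to 1, against the triangle inequalities. Hence no pair sums to
        \<open>?\<delta>\<close> and the required equality holds vacuously.\<close>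
      ultimately have False by linarith
      then show "\<alpha> = \<beta>" ..
    qed
    moreover have "Poly_Mapping.lookup f ?\<delta> = - 4"
      unfolding expand lookup_add lookup_single when_def mon4_eq_iff[OF ne] by simp
    ultimately show False by simp
  qed
  ultimately show ?thesis by blast
qed

section \<open>Choice of variables and the case distinction\<close>

lemma obtain_three_distinct:
  assumes "CARD('n::finite) \<ge> 3"
  obtains x y z :: "'n::finite" where "x \<noteq> y" "x \<noteq> z" "y \<noteq> z"
proof -
  obtain S :: "'n set" where "card S = 3"
    using obtain_subset_with_card_n[OF assms] by blast
  then show thesis using that by (auto simp: card_3_iff)
qed

lemma obtain_four_distinct:
  assumes "CARD('n::finite) \<ge> 4"
  obtains x y z w :: "'n::finite" where "x \<noteq> y" "x \<noteq> z" "y \<noteq> z" "x \<noteq> w" "y \<noteq> w" "z \<noteq> w"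
proof -
  have "CARD('n) \<ge> 3" using assms by simp
  then obtain x y z :: 'n where xyz: "x \<noteq> y" "x \<noteq> z" "y \<noteq> z"
    by (rule obtain_three_distinct)
  have "card {x, y, z} < CARD('n)"
    using assms xyz by simp
  then have "{x, y, z} \<noteq> UNIV" by auto
  then obtain w where "w \<notin> {x, y, z}" by blast
  then show thesis using that[OF xyz, of w] by auto
qed

theorem theorem5p1:
  fixes d :: nat
  assumes "CARD('n::finite) \<ge> 2" and "d \<ge> 1"
    and "\<not> hilbert_case CARD('n) (2 * d)"
  shows "(sos_forms d \<union> sonc_forms d :: 'n rpoly set) \<subset> sos_plus_sonc_forms d \<and>
         (sos_plus_sonc_forms d :: 'n rpoly set) \<subset> psd_forms d"
proof -
  \<comment> \<open>The excluded case (3,4) forces a fourth variable when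
    \<open>d = 2\<close>.\<close>
  have n: "CARD('n) \<ge> 3" and "d \<ge> 2" "d \<ge> 3 \<or> CARD('n) \<ge> 4"
    using assms by (auto simp: hilbert_case_def)
  then consider "d \<ge> 3" | "d = 2" "CARD('n) \<ge> 4" by linarith
  then have "(\<exists>f \<in> sos_plus_sonc_forms d :: 'n rpoly set. f \<notin> sos_forms d \<and> f \<notin> sonc_forms d)
    \<and> (\<exists>f \<in> psd_forms d :: 'n rpoly set. f \<notin> sos_plus_sonc_forms d)"
  proof cases
    case 1
    then obtain k where d: "d = k + 3" using le_Suc_ex[of 3 d] by (auto simp: add.commute)
    from n obtain x y z :: 'n where xyz: "x \<noteq> y" "x \<noteq> z" "y \<noteq> z" by (rule obtain_three_distinct)
    show ?thesis
      unfolding d using sextic_sum_separates[OF xyz, of k] robinson_sextic_psd[of x y z k]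
        robinson_sextic_not_sos_plus_sonc[OF xyz, of k] by blast
  next
    case 2
    from 2(2) obtain x y z w :: 'n
      where ne: "x \<noteq> y" "x \<noteq> z" "y \<noteq> z" "x \<noteq> w" "y \<noteq> w" "z \<noteq> w"
      by (rule obtain_four_distinct)
    show ?thesis
      unfolding 2(1) using quartic_sum_separates[OF ne] robinson_quartic_psd[of x y z w]
        robinson_quartic_not_sos_plus_sonc[OF ne] by blast
  qed
  then show ?thesis
    using sos_subset_sos_plus_sonc sonc_subset_sos_plus_sonc sos_plus_sonc_subset_psd by blast
qed

end
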